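(* Let $k\ge 2$ be an integer and run the algorithm \textsc{TwoLevelEstimator} with parameter $k$ (described in the context) on a stream of updates to a vector $f\in\mathbb{Z}^n$. Then: (i) ignoring the space to store the hash functions $h_1,h_2$ and the tables $T_1,T_2$, the algorithm uses $O(k\log k)$ bits of space; (ii) the hash functions $h_1,h_2$ and tables $T_1,T_2$ require an additional $O((\log k)(\log n)+k\log^2 k)$ bits; (iii) the time to process a stream update is $O(\log k)$; (iv) if $L_1=\|f\|_1\le k$ at the end of the stream, then the final output of the algorithm equals $L_1$ exactly with probability at least $3/4$.
   Context: Streaming model: a vector $f\in\mathbb{Z}^n$, initially $0$, is updated by a stream of exactly $2n$ updates $(i,v)\in[n]\times\{-M,\dots,M\}$, each meaning $f_i\leftarrow f_i+v$; for each $j\in[n]$ there are exactly two updates with index $j$, at most one of whose values is negative and at most one positive. $L_1$ denotes $\|f\|_1=\sum_i|f_i|$ at the end of the stream. Here $[A]=\{1,\dots,A\}$ and all logarithms are base 2. Running time is measured in machine word operations on a word RAM whose words have $\Omega(\log(nM))$ bits and where integers polynomially large in $k$ fit in a word. Algorithm \textsc{TwoLevelEstimator} with parameter $k$: Let $C=4(5\lceil\log k\rceil+24)^2\lceil k/\log k\rceil+1$, let $p$ be a prime with $C\le p\le 2C$, let $g$ be a generator of $\mathbb{F}_p^*$, and precompute tables $T_1[i]=g^i \bmod p$ for $0\le i\le p-2$ and $T_2[x]=$ the discrete logarithm of $x$ base $g$ for $1\le x\le p-1$. Set $t=2\lceil\log k\rceil+12$, $s=2t+\lceil\log k\rceil$,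 $B=\lceil k/\log k\rceil$. Pick a random $h_1:[n]\to[B]$ from a $t$-wise independent hash family and a random $h_2:[n]\to[p-1]$ from a pairwise independent hash family (a family with domain $[a]$ and range $[b]$ is obtained by choosing a prime $\ell\ge 2\max\{a,b\}$, a random $h'$ from a standard polynomial (Carter–Wegman) $m$-wise independent family on $[\ell]$, and setting $h(x)=(h'(x)\bmod b)+1$). For each $j\in[B]$ maintain $2s$ counters $X^j_1,\dots,X^j_{2s}$ modulo $p$, initially $0$. On update $(i,v)$, for each $z\in[2s]$ increment $X^{h_1(i)}_z$ by $v\cdot(h_2(i))^z$ modulo $p$. At the end of the stream, for each $j\in[B]$ attempt to recover the nonzero entries of an $s$-sparse vector $f_j=((f_j)_x)_{x\in\mathbb{F}_p^*}$ with $\sum_{x\in\mathbb{F}_p^*}(f_j)_x x^z=X^j_z$ for all $z\in[2s]$, using the algorithm of Dodis et al. (which, for prime $p$ and an $s$-sparse vector $r$ indexed by $\mathbb{F}_p^*$ with $2s+1<p$, recovers $\{(x,r_x):r_x\ne0\}$ from $\sum_x r_x x^i$, $i\in[2s]$, using $O(s^2+s(\log s)(\log\log s)(\log p))$ field operations). Define $\sigma:\mathrm{GF}(p)\to\mathbb{Z}$ by $\sigma(\alpha)=\alpha$ if $\alpha\le p/2$ and $\sigma(\alpha)=\alpha-p$ otherwise. Output $\sum_{j=1}^{B}\sum_{x:(f_j)_x\ne0}|\sigma((f_j)_x)|$.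
   Formalization: In (ii) and (iii) the hash primes ℓ are also assumed at most a constant times max{a,b} (for huge ℓ the bounds fail), and the recovery algorithm is assumed to return an s-sparse vector within its operation bound even on inputs that are not power sums of an s-sparse vector. *)

theory Defs
  imports
    "HOL-Probability.Probability"
    "HOL-Number_Theory.Number_Theory"
    "HOL-Library.Log_Nat"
    "HOL-Library.Monad_Syntax"
begin

section \<open>Streams\<close>

definition valid_stream :: "nat \<Rightarrow> nat \<Rightarrow> (nat \<times> int) list \<Rightarrow> bool" where
  "valid_stream n M us \<longleftrightarrow>
     length us = 2 * n \<and>
     (\<forall>(i, v) \<in> set us. i \<in> {1..n} \<and> \<bar>v\<bar> \<le> int M) \<and>
     (\<forall>j \<in> {1..n}.
        length (filter (\<lambda>(i, v). i = j) us) = 2 \<and>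
        length (filter (\<lambda>(i, v). i = j \<and> v < 0) us) \<le> 1 \<and>
        length (filter (\<lambda>(i, v). i = j \<and> v > 0) us) \<le> 1)"

definition freq :: "(nat \<times> int) list \<Rightarrow> nat \<Rightarrow> int" where
  "freq us j = (\<Sum>(i, v)\<leftarrow>us. if i = j then v else 0)"

definition L1 :: "nat \<Rightarrow> (nat \<times> int) list \<Rightarrow> int" where
  "L1 n us = (\<Sum>j = 1..n. \<bar>freq us j\<bar>)"


section \<open>Word RAM with bit-packed memory\<close>

text \<open>
  The memory consists of a fixed number of packed arrays. An array is a cell width in bits together
  with its cells; whatever is stored in a cell is truncated to the cell width, so that
  width times length is the number of bits that the array really occupies.
  A program returns its result, the new memory and the number of word operations it has
  executed; its first argument is the word length. The constantly many local variables of a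
  program are machine registers; space is charged for memory only.
\<close>

datatype region = Params | Counters | Table1 | Table2 | Hash1 | Hash2

type_synonym memory = "region \<Rightarrow> nat \<times> nat list"

type_synonym 'a prog = "nat \<Rightarrow> memory \<Rightarrow> 'a \<times> memory \<times> nat"

definition width :: "memory \<Rightarrow> region \<Rightarrow> nat" where
  "width m R = fst (m R)"

definition cells :: "memory \<Rightarrow> region \<Rightarrow> nat list" where
  "cells m R = snd (m R)"

definition bits :: "memory \<Rightarrow> region \<Rightarrow> nat" where
  "bits m R = width m R * length (cells m R)"

definition pack :: "nat \<Rightarrow> nat list \<Rightarrow> nat \<times> nat list" where
  "pack b xs = (b, map (\<lambda>x. x mod 2 ^ b) xs)"

definition ret :: "'a \<Rightarrow> 'a prog" where
  "ret x = (\<lambda>w m. (x, m, 0))"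

definition bind_prog :: "'a prog \<Rightarrow> ('a \<Rightarrow> 'b prog) \<Rightarrow> 'b prog" where
  "bind_prog f h = (\<lambda>w m. case f w m of (x, m', c) \<Rightarrow>
                          (case h x w m' of (y, m'', c') \<Rightarrow> (y, m'', c + c')))"

adhoc_overloading Monad_Syntax.bind \<rightleftharpoons> bind_prog

definition words :: "nat \<Rightarrow> int \<Rightarrow> nat" where
  "words w x = 1 + floorlog 2 (nat \<bar>x\<bar>) div w"

text \<open>
  Used with addition, subtraction, multiplication and remainder only. An operand that is longer than a
  word is processed by schoolbook multi-word arithmetic, with cost quadratic in the number of words.
\<close>

definition arith :: "(int \<Rightarrow> int \<Rightarrow> int) \<Rightarrow> int \<Rightarrow> int \<Rightarrow> int prog" where
  "arith f x y = (\<lambda>w m. (f x y, m, (words w x + words w y)\<^sup>2))"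

text \<open>
  Accessing cell a of an array of cell width b: one multiplication locates bit a * b, and the cell is
  spread over at most b div w + 2 words.
\<close>

definition access_cost :: "nat \<Rightarrow> nat \<Rightarrow> int \<Rightarrow> nat" where
  "access_cost w b a = (words w a + words w (int b))\<^sup>2 + (b div w + 2)"

definition rd :: "region \<Rightarrow> int \<Rightarrow> int prog" where
  "rd R a = (\<lambda>w m. (int (cells m R ! nat a), m, access_cost w (width m R) a))"

definition wr :: "region \<Rightarrow> int \<Rightarrow> int \<Rightarrow> unit prog" where
  "wr R a x = (\<lambda>w m.
     ((), m(R := (width m R, (cells m R)[nat a := nat (x mod 2 ^ width m R)])),
      access_cost w (width m R) a))"

text \<open>Executes the body for the \<open>N\<close> values \<open>z, z + 1, \<dots>\<close> of the loop variable.\<close>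

fun for_loop :: "nat \<Rightarrow> int \<Rightarrow> (int \<Rightarrow> 'a \<Rightarrow> 'a prog) \<Rightarrow> 'a \<Rightarrow> 'a prog" where
  "for_loop 0 z body x = ret x"
| "for_loop (Suc N) z body x = do {
     y \<leftarrow> body z x;
     z' \<leftarrow> arith (+) z 1;
     _ \<leftarrow> arith (-) (int (Suc N)) 1;
     for_loop N z' body y
   }"


section \<open>Parameters\<close>

definition clog :: "nat \<Rightarrow> nat" where
  "clog k = nat \<lceil>log 2 (real k)\<rceil>"

definition par_B :: "nat \<Rightarrow> nat" where
  "par_B k = nat \<lceil>real k / log 2 (real k)\<rceil>"

definition par_C :: "nat \<Rightarrow> nat" where
  "par_C k = 4 * (5 * clog k + 24)\<^sup>2 * par_B k + 1"

definition par_t :: "nat \<Rightarrow> nat" where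
  "par_t k = 2 * clog k + 12"

definition par_s :: "nat \<Rightarrow> nat" where
  "par_s k = 2 * par_t k + clog k"

text \<open>\<open>l1\<close> and \<open>l2\<close> are the prime moduli of the polynomial families behind \<open>h\<^sub>1\<close> and \<open>h\<^sub>2\<close>.\<close>

definition valid_params :: "nat \<Rightarrow> nat \<Rightarrow> nat \<Rightarrow> nat \<Rightarrow> nat \<Rightarrow> nat \<Rightarrow> nat \<Rightarrow> bool" where
  "valid_params k n M p g l1 l2 \<longleftrightarrow>
     2 \<le> k \<and> 1 \<le> n \<and> 1 \<le> M \<and>
     prime p \<and> par_C k \<le> p \<and> p \<le> 2 * par_C k \<and>
     g \<in> {1..<p} \<and> residue_primroot p g \<and>
     prime l1 \<and> 2 * max n (par_B k) \<le> l1 \<and>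
     prime l2 \<and> 2 * max n (p - 1) \<le> l2"

text \<open>
  The cost of storing and evaluating the hash functions depends on the size of their moduli.
  By Bertrand's postulate suitable primes exist for every \<open>a \<ge> 4\<close>.
\<close>

definition moduli_bounded :: "real \<Rightarrow> nat \<Rightarrow> nat \<Rightarrow> nat \<Rightarrow> nat \<Rightarrow> nat \<Rightarrow> bool" where
  "moduli_bounded a k n p l1 l2 \<longleftrightarrow>
     real l1 \<le> a * real (max n (par_B k)) \<and> real l2 \<le> a * real (max n (p - 1))"

definition word_length_ok :: "real \<Rightarrow> nat \<Rightarrow> nat \<Rightarrow> nat \<Rightarrow> nat \<Rightarrow> bool" where
  "word_length_ok c k n M w \<longleftrightarrow>
     c * log 2 (real (n * M)) \<le> real w \<and> c * log 2 (real k) \<le> real w"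

text \<open>Coefficient vectors of the polynomials of degree less than \<open>m\<close> over the field of size \<open>l\<close>.\<close>

definition seeds :: "nat \<Rightarrow> nat \<Rightarrow> nat list set" where
  "seeds l m = {cs. length cs = m \<and> set cs \<subseteq> {..<l}}"


section \<open>TwoLevelEstimator\<close>

definition dlog :: "nat \<Rightarrow> nat \<Rightarrow> nat \<Rightarrow> nat" where
  "dlog p g x = (THE i. i < p - 1 \<and> [g ^ i = x] (mod p))"

definition init :: "nat \<Rightarrow> nat \<Rightarrow> nat \<Rightarrow> nat \<Rightarrow> nat \<Rightarrow> nat list \<Rightarrow> nat list \<Rightarrow> memory" where
  "init k p g l1 l2 cs1 cs2 R =
     (case R of
        Params \<Rightarrow> pack (floorlog 2 p) [p, par_B k, par_s k, par_t k]
      | Counters \<Rightarrow> pack (floorlog 2 p) (replicate (par_B k * (2 * par_s k)) 0)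
      | Table1 \<Rightarrow> pack (floorlog 2 p) (map (\<lambda>i. g ^ i mod p) [0..<p - 1])
      | Table2 \<Rightarrow> pack (floorlog 2 p) (map (dlog p g) [1..<p])
      | Hash1 \<Rightarrow> pack (floorlog 2 l1) (l1 # par_B k # cs1)
      | Hash2 \<Rightarrow> pack (floorlog 2 l2) (l2 # (p - 1) # cs2))"

text \<open>
  \<open>R\<close> holds the modulus \<open>l\<close>, the range \<open>b\<close> and the \<open>N\<close> coefficients of the polynomial, highest degree
  first; the polynomial is evaluated by Horner's rule, with values in \<open>{0..<l}\<close>.
\<close>

definition hash :: "region \<Rightarrow> int \<Rightarrow> int \<Rightarrow> int prog" where
  "hash R N x = do {
     l \<leftarrow> rd R 0;
     b \<leftarrow> rd R 1;
     y \<leftarrow> for_loop (nat N) 2 (\<lambda>a acc. do {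
            c \<leftarrow> rd R a;
            u \<leftarrow> arith (*) acc x;
            u' \<leftarrow> arith (+) u c;
            arith (mod) u' l
          }) 0;
     y' \<leftarrow> arith (mod) y b;
     arith (+) y' 1
   }"

text \<open>
  Counter \<open>X\<^sup>j\<^sub>z\<close> is cell \<open>(j - 1) * 2s + (z - 1)\<close> of the counter array, the discrete logarithm of
  \<open>x\<close> is cell \<open>x - 1\<close> of the second table, and \<open>x ^ z\<close> is computed as \<open>g ^ (z * dlog x)\<close> from the
  two tables.
\<close>

definition update :: "nat \<times> int \<Rightarrow> unit prog" where
  "update u = do {
     let i = int (fst u);
     let v = snd u;
     p \<leftarrow> rd Params 0;
     s \<leftarrow> rd Params 2;
     t \<leftarrow> rd Params 3;
     j \<leftarrow> hash Hash1 t i;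
     x \<leftarrow> hash Hash2 2 i;
     v' \<leftarrow> arith (mod) v p;
     x' \<leftarrow> arith (-) x 1;
     e \<leftarrow> rd Table2 x';
     q \<leftarrow> arith (-) p 1;
     r \<leftarrow> arith (*) 2 s;
     j' \<leftarrow> arith (-) j 1;
     base \<leftarrow> arith (*) j' r;
     for_loop (nat r) 1 (\<lambda>z _. do {
       ez \<leftarrow> arith (*) e z;
       ez' \<leftarrow> arith (mod) ez q;
       y \<leftarrow> rd Table1 ez';
       d \<leftarrow> arith (*) v' y;
       z' \<leftarrow> arith (-) z 1;
       a \<leftarrow> arith (+) base z';
       X \<leftarrow> rd Counters a;
       X' \<leftarrow> arith (+) X d;
       X'' \<leftarrow> arith (mod) X' p;
       wr Counters a X''
     }) ()
   }"

definition update_time :: "nat \<Rightarrow> nat \<times> int \<Rightarrow> memory \<Rightarrow> nat" where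
  "update_time w u m = snd (snd (update u w m))"

definition process :: "nat \<Rightarrow> (nat \<times> int) list \<Rightarrow> memory \<Rightarrow> memory" where
  "process w us m = foldl (\<lambda>m u. fst (snd (update u w m))) m us"

text \<open>
  A decoder maps \<open>p\<close>, \<open>s\<close> and \<open>2s\<close> power sums to the list of pairs \<open>(x, r\<^sub>x)\<close> with \<open>r\<^sub>x \<noteq> 0\<close>,
  together with the number of field operations it has executed.
\<close>

type_synonym decoder = "nat \<Rightarrow> nat \<Rightarrow> nat list \<Rightarrow> (nat \<times> nat) list \<times> nat"

definition power_sums :: "nat \<Rightarrow> nat \<Rightarrow> (nat \<Rightarrow> nat) \<Rightarrow> nat list" where
  "power_sums p s r = map (\<lambda>z. (\<Sum>x\<in>{1..<p}. r x * x ^ z) mod p) [1..<2 * s + 1]"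

text \<open>
  The properties of the algorithm of Dodis et al. On a list that is not the list of power sums of any
  \<open>s\<close>-sparse vector, nothing is known about the output except that it describes some \<open>s\<close>-sparse
  vector. Small \<open>s\<close> is excluded because \<open>log s * log (log s)\<close> vanishes for \<open>s = 1\<close> and \<open>s = 2\<close>.
\<close>

definition sparse_recovery :: "real \<Rightarrow> decoder \<Rightarrow> bool" where
  "sparse_recovery D dec \<longleftrightarrow>
     (\<forall>p s X. prime p \<and> 3 \<le> s \<and> 2 * s + 1 < p \<and> length X = 2 * s \<and> set X \<subseteq> {..<p} \<longrightarrow>
        (case dec p s X of (out, ops) \<Rightarrow>
           length out \<le> s \<and> distinct (map fst out) \<and> set out \<subseteq> {1..<p} \<times> {1..<p} \<and>
           real ops \<le> D * ((real s)\<^sup>2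
             + real s * log 2 (real s) * log 2 (log 2 (real s)) * log 2 (real p)) \<and>
           (\<forall>r. (\<forall>x\<in>{1..<p}. r x < p) \<and> card {x\<in>{1..<p}. r x \<noteq> 0} \<le> s \<and> X = power_sums p s r
                \<longrightarrow> set out = {(x, r x) |x. x \<in> {1..<p} \<and> r x \<noteq> 0})))"

definition sigma :: "nat \<Rightarrow> nat \<Rightarrow> int" where
  "sigma p \<alpha> = (if real \<alpha> \<le> real p / 2 then int \<alpha> else int \<alpha> - int p)"

definition recovered :: "decoder \<Rightarrow> memory \<Rightarrow> nat \<Rightarrow> (nat \<times> nat) list \<times> nat" where
  "recovered dec m j =
     (let p = cells m Params ! 0; s = cells m Params ! 2
      in dec p s (take (2 * s) (drop ((j - 1) * (2 * s)) (cells m Counters))))"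

definition report :: "decoder \<Rightarrow> memory \<Rightarrow> int" where
  "report dec m =
     (\<Sum>j = 1..cells m Params ! 1.
        \<Sum>(x, y)\<leftarrow>fst (recovered dec m j). \<bar>sigma (cells m Params ! 0) y\<bar>)"

text \<open>
  Additional space needed to produce the output: the buckets are decoded one after the other in the same
  work space. It holds a copy of the \<open>2s\<close> power sums, one field element for the result of each field
  operation, and the recovered pairs. The bucket index and the running total come on top.
\<close>

definition report_bits :: "decoder \<Rightarrow> memory \<Rightarrow> nat" where
  "report_bits dec m =
     (MAX j\<in>{1..cells m Params ! 1}.
        (2 * (cells m Params ! 2) + snd (recovered dec m j) + 2 * length (fst (recovered dec m j)))
        * width m Params)
     + floorlog 2 (cells m Params ! 1) + floorlog 2 (nat (report dec m))"

definition sketch_bits :: "memory \<Rightarrow> nat" where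
  "sketch_bits m = bits m Params + bits m Counters"

definition hash_table_bits :: "memory \<Rightarrow> nat" where
  "hash_table_bits m = bits m Hash1 + bits m Hash2 + bits m Table1 + bits m Table2"

end

theory Submission
  imports Defs
begin

text \<open>
  Since the counters are linear in the stream, the memory after any prefix has a closed form: counter
  \<open>z\<close> of bucket \<open>j\<close> is the power sum \<open>\<Sum> f\<^sub>i h\<^sub>2(i)\<^sup>z\<close> over the \<open>i\<close> with \<open>h\<^sub>1(i) = j\<close>, modulo \<open>p\<close>.
  An update performs \<open>O(log k)\<close> operations on numbers of \<open>O(log (n M) + log k)\<close> bits, which is
  \<open>O(1)\<close> words.

  The output is correct as soon as every bucket contains at most \<open>s\<close> indices of the support of \<open>f\<close> and
  \<open>h\<^sub>2\<close> is injective on each of these sets. The support has at most \<open>k\<close> elements because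
  \<open>L\<^sub>1 \<le> k\<close>. Counting the \<open>t\<close>-subsets of the buckets, a bucket is overloaded with probability at
  most \<open>2\<^sup>-\<^sup>t\<close>, which is small even after the union bound over the buckets; given \<open>h\<^sub>1\<close>, there are at most
  \<open>B s\<^sup>2 / 2\<close> pairs that could collide, each with probability at most \<open>3 / (2 (p - 1))\<close>, so
  \<open>p - 1 \<ge> 4 s\<^sup>2 B\<close> bounds this failure probability by \<open>3/16\<close>.
\<close>

section \<open>Random polynomials over a prime field: interpolation and counting of seeds\<close>

section \<open>Polynomial hash families\<close>

text \<open>The mathematical value of the loop in \<open>hash\<close>: the highest coefficient comes
  first, and a reduction in every round keeps the accumulator below \<open>l\<close>.\<close>

definition horner :: "nat \<Rightarrow> nat list \<Rightarrow> nat \<Rightarrow> nat" where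
  "horner l cs x = foldl (\<lambda>acc c. (acc * x + c) mod l) 0 cs"

lemma horner_Nil [simp]: "horner l [] x = 0"
  by (simp add: horner_def)

lemma horner_snoc: "horner l (cs @ [c]) x = (horner l cs x * x + c) mod l"
  by (simp add: horner_def)

lemma horner_less: "l > 0 \<Longrightarrow> horner l cs x < l"
  by (cases cs rule: rev_cases) (simp_all add: horner_snoc)

text \<open>\<open>Poly\<close> takes coefficients from the constant term upwards, hence
  \<open>rev\<close>. Integer polynomials up to congruence avoid a field type that would depend on
  \<open>l\<close>.\<close>

lemma horner_cong_poly:
  "[int (horner l cs x) = poly (Poly (map int (rev cs))) (int x)] (mod int l)"
proof (induction cs rule: rev_induct)
  case (snoc c cs)
  have "[int (horner l (cs @ [c]) x) = int (horner l cs x) * int x + int c] (mod int l)"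
    by (simp add: horner_snoc cong_def zmod_int)
  also have "[int (horner l cs x) * int x + int c
      = poly (Poly (map int (rev cs))) (int x) * int x + int c] (mod int l)"
    by (intro cong_add cong_mult snoc.IH cong_refl)
  finally show ?case
    by (simp add: algebra_simps)
qed simp

text \<open>The bound on the number of roots over the integers modulo \<open>l\<close>, in terms of
  divisibility. At a root \<open>x0\<close>, \<open>P\<close> is \<open>(x - x0) * Q\<close> up to a
  multiple of \<open>l\<close>; as \<open>l\<close> is prime, \<open>Q\<close> vanishes modulo
  \<open>l\<close> at the remaining points, and the induction makes all coefficients of
  \<open>Q\<close>, hence of \<open>P\<close>, divisible by \<open>l\<close>.\<close>

lemma poly_roots_mod_prime:
  fixes P :: "int poly"
  assumes "prime l" "finite T" "inj_on (\<lambda>x. x mod l) T" "Polynomial.degree P < card T"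
    and "\<And>x. x \<in> T \<Longrightarrow> l dvd poly P x"
  shows "l dvd Polynomial.coeff P i"
  using assms(2-5)
proof (induction "card T" arbitrary: T P i)
  case (Suc m)
  from Suc.hyps(2) obtain x0 T' where T': "T = insert x0 T'" "x0 \<notin> T'" "card T' = m"
    by (metis card_eq_SucD)
  define Q where "Q = synthetic_div P x0"
  have P: "P = [:- x0, 1:] * Q + [:poly P x0:]"
    unfolding Q_def by (rule synthetic_div_correct' [symmetric])
  have Q_root: "l dvd poly Q x" if "x \<in> T'" for x
  proof -
    have "l dvd poly P x - poly P x0"
      using Suc.prems(4) that T' by auto
    also have "poly P x - poly P x0 = (x - x0) * poly Q x"
      by (subst P) (simp add: algebra_simps)
    finally have "l dvd x - x0 \<or> l dvd poly Q x"
      using \<open>prime l\<close> by (simp add: prime_dvd_mult_iff)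
    moreover have "\<not> l dvd x - x0"
      using Suc.prems(2) that T' by (auto simp: inj_on_def mod_eq_dvd_iff)
    ultimately show ?thesis by blast
  qed
  \<comment> \<open>A constant \<open>P\<close> is treated apart: its quotient is zero, but the
    degree 0 of that quotient need not be below \<open>card T'\<close>, since \<open>T'\<close> may
    be empty.\<close>
  have "l dvd Polynomial.coeff Q i" for i
  proof (cases "Polynomial.degree P = 0")
    case True
    then have "Q = 0" by (simp add: Q_def synthetic_div_eq_0_iff)
    then show ?thesis by simp
  next
    case False
    show ?thesis
    proof (rule Suc.hyps(1))
      show "Polynomial.degree Q < card T'"
        using False Suc.prems(3) Suc.hyps(2) T' by (simp add: Q_def degree_synthetic_div)
    qed (use Suc.prems T' Q_root in \<open>auto simp: inj_on_def\<close>)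
  qed
  moreover have "l dvd poly P x0"
    using Suc.prems(4) T' by auto
  moreover have "Polynomial.coeff P i = Polynomial.coeff (pCons 0 Q) i - x0 * Polynomial.coeff Q i + Polynomial.coeff [:poly P x0:] i"
    by (subst P) (simp add: algebra_simps coeff_pCons split: nat.split)
  ultimately show ?case
    by (auto simp: coeff_pCons split: nat.splits)
qed simp

text \<open>Interpolation: the difference of the two polynomials has degree below \<open>m\<close>
  and \<open>m\<close> roots, so its coefficients vanish modulo \<open>l\<close>; coefficients below
  \<open>l\<close> are then equal.\<close>

lemma horner_inj:
  assumes "prime l" "finite T" "T \<subseteq> {..<l}" "card T = m"
    and cs: "cs \<in> seeds l m" "ds \<in> seeds l m"
    and eq: "\<And>x. x \<in> T \<Longrightarrow> horner l cs x = horner l ds x"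
  shows "cs = ds"
proof (cases "m = 0")
  case False
  define P where "P = Poly (map int (rev cs)) - Poly (map int (rev ds))"
  have len: "length cs = m" "length ds = m"
    using cs by (auto simp: seeds_def)
  have "Polynomial.degree P < card (int ` T)"
  proof -
    have "Polynomial.degree (Poly (map int (rev es))) < m" if "length es = m" for es
    proof -
      have "Polynomial.degree (Poly (map int (rev es))) \<le> m - 1"
        using that by (intro degree_le) (auto simp: coeff_Poly_eq nth_default_def)
      then show ?thesis using False by linarith
    qed
    with len have "Polynomial.degree (Poly (map int (rev cs))) < m"
      "Polynomial.degree (Poly (map int (rev ds))) < m" by blast+
    then show ?thesis
      unfolding P_def using \<open>card T = m\<close> by (intro degree_diff_less) (simp_all add: card_image)
  qed
  moreover have "inj_on (\<lambda>x. x mod int l) (int ` T)"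
  proof (rule inj_onI)
    fix x y assume *: "x \<in> int ` T" "y \<in> int ` T" "x mod int l = y mod int l"
    then have "0 \<le> x" "x < int l" "0 \<le> y" "y < int l" using assms(3) by auto
    then show "x = y" using *(3) by simp
  qed
  moreover have "int l dvd poly P x" if "x \<in> int ` T" for x
    using that eq horner_cong_poly[of l cs] horner_cong_poly[of l ds]
    by (metis (no_types, lifting) P_def cong_iff_dvd_diff cong_sym cong_trans image_iff poly_diff)
  ultimately have dvd: "int l dvd Polynomial.coeff P i" for i
    using poly_roots_mod_prime [of "int l" "int ` T" P i] assms by simp
  have "rev cs ! i = rev ds ! i" if "i < m" for i
  proof -
    have "rev cs ! i \<in> set (rev cs)" "rev ds ! i \<in> set (rev ds)"
      using that len by (metis length_rev nth_mem)+
    then have "rev cs ! i < l" "rev ds ! i < l"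
      using cs by (auto simp: seeds_def)
    moreover have "[int (rev cs ! i) = int (rev ds ! i)] (mod int l)"
      using dvd[of i] that len
      by (simp add: P_def cong_iff_dvd_diff coeff_Poly_eq nth_default_nth rev_map)
    ultimately show ?thesis
      by (metis cong_int_iff cong_less_modulus_unique_nat)
  qed
  then have "rev cs = rev ds"
    using len by (intro nth_equalityI) auto
  then show ?thesis by simp
qed (use cs in \<open>auto simp: seeds_def\<close>)

lemma seeds_finite [simp]: "finite (seeds l m)"
  unfolding seeds_def using finite_lists_length_eq[of "{..<l}" m] by (simp add: conj_commute)

lemma card_seeds: "card (seeds l m) = l ^ m"
  unfolding seeds_def using card_lists_length_eq[of "{..<l}" m] by (simp add: conj_commute)

text \<open>By \<open>horner_inj\<close> a seed is determined by its values on \<open>T\<close>, so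
  the seeds counted here embed into the functions from \<open>T\<close> to \<open>A\<close>.\<close>

lemma card_seeds_horner_in_le:
  assumes "prime l" "finite T" "T \<subseteq> {..<l}" "card T = m" "finite A"
  shows "card {cs \<in> seeds l m. \<forall>x\<in>T. horner l cs x \<in> A} \<le> card A ^ m"
proof -
  let ?S = "{cs \<in> seeds l m. \<forall>x\<in>T. horner l cs x \<in> A}"
  have "card ?S \<le> card (T \<rightarrow>\<^sub>E A)"
  proof (rule card_inj_on_le [where f = "\<lambda>cs. restrict (horner l cs) T"])
    show "inj_on (\<lambda>cs. restrict (horner l cs) T) ?S"
    proof (rule inj_onI)
      fix cs ds
      assume *: "cs \<in> ?S" "ds \<in> ?S" "restrict (horner l cs) T = restrict (horner l ds) T"
      then have "horner l cs x = horner l ds x" if "x \<in> T" for x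
        using that by (metis restrict_apply')
      then show "cs = ds"
        using horner_inj[OF assms(1-4)] * by blast
    qed
    show "(\<lambda>cs. restrict (horner l cs) T) ` ?S \<subseteq> T \<rightarrow>\<^sub>E A"
      by auto
    show "finite (T \<rightarrow>\<^sub>E A)"
      using assms by (intro finite_PiE) auto
  qed
  also have "\<dots> = card A ^ m"
    using assms by (simp add: card_PiE)
  finally show ?thesis .
qed

section \<open>Reduction of the values to the range \<open>{1..b}\<close> and the resulting loss of
  uniformity\<close>

definition hval :: "nat \<Rightarrow> nat \<Rightarrow> nat list \<Rightarrow> nat \<Rightarrow> nat" where
  "hval l b cs x = horner l cs x mod b + 1"

lemma hval_bounds: "b > 0 \<Longrightarrow> hval l b cs x \<in> {1..b}"
  by (simp add: hval_def Suc_le_eq)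

lemma card_residue_class_le:
  assumes "b > 0"
  shows "card {y. y < l \<and> y mod b + 1 = j} \<le> l div b + 1"
proof -
  have "card {y. y < l \<and> y mod b + 1 = j} \<le> card {..l div b}"
  proof (rule card_inj_on_le [where f = "\<lambda>y. y div b"])
    show "inj_on (\<lambda>y. y div b) {y. y < l \<and> y mod b + 1 = j}"
    proof (rule inj_onI)
      fix x y assume "x \<in> {y. y < l \<and> y mod b + 1 = j}" "y \<in> {y. y < l \<and> y mod b + 1 = j}"
        and "x div b = y div b"
      then show "x = y" by (metis (mono_tags, lifting) add_right_cancel div_mult_mod_eq mem_Collect_eq)
    qed
  qed (auto intro: div_le_mono)
  then show ?thesis by simp
qed

lemma real_card_residue_class_le:
  assumes "b > 0" "2 * b \<le> l"
  shows "real (card {y. y < l \<and> y mod b + 1 = j}) \<le> 3 / 2 * (real l / real b)"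
proof -
  have "real (card {y. y < l \<and> y mod b + 1 = j}) \<le> real (l div b) + 1"
    using card_residue_class_le[OF assms(1), of l j] by linarith
  also have "\<dots> \<le> real l / real b + 1"
    by (simp add: of_nat_div_le_of_nat)
  \<comment> \<open>\<open>l / b\<close> is at least 2, so the rounding term 1 is at most half of
    it; this is the origin of the factor 3/2.\<close>
  also have "\<dots> \<le> real l / real b + (real l / real b) / 2"
    using assms by (simp add: field_simps)
  finally show ?thesis by simp
qed

text \<open>The family is only almost uniform: the reduction modulo the range costs the factor \<open>3/2\<close>.\<close>

lemma card_seeds_hval_le:
  assumes "prime l" "finite T" "T \<subseteq> {..<l}" "card T = m" "b > 0" "2 * b \<le> l"
  shows "real (card {cs \<in> seeds l m. \<forall>x\<in>T. hval l b cs x = j}) \<le> (3 / 2 * (real l / real b)) ^ m"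
proof -
  let ?A = "{y. y < l \<and> y mod b + 1 = j}"
  have "{cs \<in> seeds l m. \<forall>x\<in>T. hval l b cs x = j} = {cs \<in> seeds l m. \<forall>x\<in>T. horner l cs x \<in> ?A}"
    using prime_gt_0_nat[OF assms(1)] by (auto simp: hval_def horner_less)
  then have "real (card {cs \<in> seeds l m. \<forall>x\<in>T. hval l b cs x = j}) \<le> real (card ?A) ^ m"
    using card_seeds_horner_in_le[OF assms(1-4), of ?A] by (simp flip: of_nat_power)
  also have "\<dots> \<le> (3 / 2 * (real l / real b)) ^ m"
    using real_card_residue_class_le[OF assms(5,6)] by (intro power_mono) auto
  finally show ?thesis .
qed

text \<open>The colliding seeds number at most the sum of the squared class sizes. One factor of
  each square is bounded by \<open>3 / 2 * (l / b)\<close>; the other sums to exactly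
  \<open>l\<close>, because the classes partition \<open>{..<l}\<close>. Bounding both factors would
  give 9/4 in place of 3/2, too weak for the probability 3/4.\<close>

lemma card_seeds_collision_le:
  assumes "prime l" "T \<subseteq> {..<l}" "card T = 2" "b > 0" "2 * b \<le> l"
  shows "real (card {cs \<in> seeds l 2. \<exists>j. \<forall>x\<in>T. hval l b cs x = j}) \<le> 3 / 2 * (real l)\<^sup>2 / real b"
proof -
  let ?A = "\<lambda>j. {y. y < l \<and> y mod b + 1 = j}"
  let ?S = "\<lambda>j. {cs \<in> seeds l 2. \<forall>x\<in>T. horner l cs x \<in> ?A j}"
  have l: "l > 0" using assms(1) prime_gt_0_nat by blast
  have fT: "finite T" using assms(3) card.infinite by fastforce
  from assms(3) obtain x0 where x0: "x0 \<in> T" by fastforce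
  have "{cs \<in> seeds l 2. \<exists>j. \<forall>x\<in>T. hval l b cs x = j} \<subseteq> (\<Union>j\<in>{1..b}. ?S j)"
  proof
    fix cs assume "cs \<in> {cs \<in> seeds l 2. \<exists>j. \<forall>x\<in>T. hval l b cs x = j}"
    then obtain j where j: "cs \<in> seeds l 2" "\<forall>x\<in>T. hval l b cs x = j" by auto
    moreover have "j \<in> {1..b}" using j x0 hval_bounds[OF assms(4)] by metis
    ultimately show "cs \<in> (\<Union>j\<in>{1..b}. ?S j)"
      using l by (auto simp: hval_def horner_less)
  qed
  then have "card {cs \<in> seeds l 2. \<exists>j. \<forall>x\<in>T. hval l b cs x = j} \<le> (\<Sum>j\<in>{1..b}. card (?S j))"
    by (intro order.trans[OF card_mono card_UN_le]) auto
  also have "\<dots> \<le> (\<Sum>j\<in>{1..b}. card (?A j) ^ 2)"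
    using assms fT by (intro sum_mono card_seeds_horner_in_le) auto
  finally have "real (card {cs \<in> seeds l 2. \<exists>j. \<forall>x\<in>T. hval l b cs x = j})
      \<le> real (\<Sum>j\<in>{1..b}. card (?A j) ^ 2)"
    by (rule of_nat_mono)
  also have "\<dots> = (\<Sum>j\<in>{1..b}. real (card (?A j)) * real (card (?A j)))"
    by (simp add: power2_eq_square)
  also have "\<dots> \<le> (\<Sum>j\<in>{1..b}. 3 / 2 * (real l / real b) * real (card (?A j)))"
    using real_card_residue_class_le[OF assms(4,5)] by (intro sum_mono mult_right_mono) auto
  also have "\<dots> = 3 / 2 * (real l / real b) * real (\<Sum>j\<in>{1..b}. card (?A j))"
    by (simp add: sum_distrib_left)
  also have "(\<Sum>j\<in>{1..b}. card (?A j)) = card (\<Union>j\<in>{1..b}. ?A j)"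
    by (subst card_UN_disjoint) auto
  also have "(\<Union>j\<in>{1..b}. ?A j) = {..<l}"
    using assms(4) by (auto simp: Suc_le_eq)
  finally show ?thesis
    by (simp add: power2_eq_square field_simps)
qed

section \<open>Upper bounds on the cost of programs, composed along their structure\<close>

section \<open>Running programs\<close>

definition runs :: "nat \<Rightarrow> 'a prog \<Rightarrow> memory \<Rightarrow> 'a \<Rightarrow> memory \<Rightarrow> nat \<Rightarrow> bool" where
  "runs w f m x m' C \<longleftrightarrow> (\<exists>c\<le>C. f w m = (x, m', c))"

lemma runs_ret: "runs w (ret x) m x m C"
  by (simp add: runs_def ret_def)

lemma runs_bind:
  assumes "runs w f m x m' C" "runs w (h x) m' y m'' C'"
  shows "runs w (bind_prog f h) m y m'' (C + C')"
  using assms by (force simp: runs_def bind_prog_def)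

lemma runs_mono: "runs w f m x m' C \<Longrightarrow> C \<le> C' \<Longrightarrow> runs w f m x m' C'"
  unfolding runs_def using order.trans by blast

text \<open>One price for every elementary operation with operands bounded by \<open>Y\<close>. If
  these have at most \<open>W\<close> words, arithmetic costs at most \<open>4 * W\<^sup>2\<close>,
  and a cell access exceeds this by \<open>b div w + 2\<close>, which is at most
  \<open>3 * W\<^sup>2\<close>.\<close>

definition op_cost :: "nat \<Rightarrow> nat \<Rightarrow> nat" where
  "op_cost w Y = 7 * (words w (int Y))\<^sup>2"

lemma words_mono: "\<bar>x\<bar> \<le> int Y \<Longrightarrow> words w x \<le> words w (int Y)"
  unfolding words_def by (simp add: div_le_mono floorlog_mono)

lemma runs_arith:
  assumes "\<bar>x\<bar> \<le> int Y" "\<bar>y\<bar> \<le> int Y" "f x y = z"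
  shows "runs w (arith f x y) m z m (op_cost w Y)"
proof -
  have "(words w x + words w y)\<^sup>2 \<le> (2 * words w (int Y))\<^sup>2"
    using words_mono[OF assms(1), of w] words_mono[OF assms(2), of w] by (intro power_mono) auto
  also have "\<dots> \<le> op_cost w Y"
    by (simp add: op_cost_def power_mult_distrib)
  finally show ?thesis
    using assms(3) by (simp add: runs_def arith_def)
qed

lemma access_cost_le:
  assumes "\<bar>a\<bar> \<le> int Y" "b \<le> floorlog 2 Y"
  shows "access_cost w b a \<le> op_cost w Y"
proof -
  define W where "W = words w (int Y)"
  \<comment> \<open>The cell width is itself an operand of the address multiplication, so it too has
    to be bounded by \<open>Y\<close>.\<close>
  have "floorlog 2 Y \<le> Y"
    by (rule floorlog_leI) auto
  then have "words w a + words w (int b) \<le> 2 * W"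
    using words_mono[OF assms(1), of w] words_mono[of "int b" Y w] assms(2) by (auto simp: W_def)
  then have "(words w a + words w (int b))\<^sup>2 \<le> (2 * W)\<^sup>2"
    by (intro power_mono) auto
  moreover have "b div w + 1 \<le> W"
    using assms(2) by (simp add: W_def words_def div_le_mono)
  moreover have "W \<le> W\<^sup>2" "1 \<le> W\<^sup>2"
    using \<open>b div w + 1 \<le> W\<close> by (auto simp: power2_eq_square)
  ultimately show ?thesis
    unfolding access_cost_def op_cost_def W_def[symmetric]
    by (simp add: power_mult_distrib)
qed

lemma runs_rd:
  assumes "\<bar>a\<bar> \<le> int Y" "width m R \<le> floorlog 2 Y" "int (cells m R ! nat a) = x"
  shows "runs w (rd R a) m x m (op_cost w Y)"
  using access_cost_le[OF assms(1,2), of w] assms(3) by (simp add: runs_def rd_def)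

lemma runs_wr:
  assumes "\<bar>a\<bar> \<le> int Y" "width m R \<le> floorlog 2 Y"
    and "m' = m(R := (width m R, (cells m R)[nat a := nat (x mod 2 ^ width m R)]))"
  shows "runs w (wr R a x) m () m' (op_cost w Y)"
  using access_cost_le[OF assms(1,2), of w] assms(3) by (simp add: runs_def wr_def)

text \<open>The invariant is a pair of sequences: \<open>st i\<close> and \<open>mem i\<close> are
  value and memory after \<open>i\<close> rounds. Besides the body, a round pays for incrementing
  the loop variable and decrementing the number of remaining rounds.\<close>

lemma runs_for_loop:
  assumes "\<And>i. i < N \<Longrightarrow> runs w (body (z + int i) (st i)) (mem i) (st (Suc i)) (mem (Suc i)) C"
    and "0 \<le> z" "z + int N \<le> int Y" "1 \<le> Y"
  shows "runs w (for_loop N z body (st 0)) (mem 0) (st N) (mem N) (N * (C + 2 * op_cost w Y))"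
  using assms
proof (induction N arbitrary: z st mem)
  case 0
  show ?case by (simp add: runs_ret)
next
  case (Suc N)
  have "runs w (for_loop N (z + 1) body (st (Suc 0))) (mem (Suc 0)) (st (Suc N)) (mem (Suc N))
     (N * (C + 2 * op_cost w Y))"
  proof (rule Suc.IH[of "z + 1" "\<lambda>i. st (Suc i)" "\<lambda>i. mem (Suc i)"])
    fix i assume "i < N"
    then show "runs w (body (z + 1 + int i) (st (Suc i))) (mem (Suc i)) (st (Suc (Suc i)))
        (mem (Suc (Suc i))) C"
      using Suc.prems(1)[of "Suc i"] by (simp add: add_ac)
  qed (use Suc.prems in auto)
  moreover have "runs w (body z (st 0)) (mem 0) (st (Suc 0)) (mem (Suc 0)) C"
    using Suc.prems(1)[of 0] by simp
  ultimately have "runs w (for_loop (Suc N) z body (st 0)) (mem 0) (st (Suc N)) (mem (Suc N))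
      (C + (op_cost w Y + (op_cost w Y + N * (C + 2 * op_cost w Y))))"
    unfolding for_loop.simps
    by (intro runs_bind) (assumption | rule runs_arith refl | use Suc.prems in simp)+
  then show ?case
    by (rule runs_mono) simp
qed

text \<open>After \<open>i\<close> rounds the accumulator is the Horner value of
  \<open>take i cs\<close>. Intermediate results are at most \<open>l * l + l\<close>, hence at most
  \<open>2 * l * l\<close>. A coefficient costs four operations and two of loop control; two reads,
  a remainder and an increment lie outside the loop.\<close>

lemma runs_hash:
  fixes cs :: "nat list" and x :: nat
  assumes m: "m R = (floorlog 2 l, l # b # cs)" and cs: "set cs \<subseteq> {..<l}"
    and l: "0 < l" "0 < b" "b \<le> l" "x \<le> l" and len: "length cs + 2 \<le> Y"
    and Y: "2 * l * l \<le> Y" and N: "N = int (length cs)"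
  shows "runs w (hash R N (int x)) m (int (hval l b cs x)) m ((6 * length cs + 4) * op_cost w Y)"
proof -
  let ?c = "op_cost w Y"
  have "l * 1 \<le> l * l" using l by (intro mult_left_mono) auto
  with Y have lY: "l \<le> Y" by linarith
  have w: "width m R \<le> floorlog 2 Y"
    using m lY by (simp add: width_def floorlog_mono)
  have c: "cells m R = l # b # cs"
    using m by (simp add: cells_def)
  let ?body = "\<lambda>a acc. do {
            c \<leftarrow> rd R a;
            u \<leftarrow> arith (*) acc (int x);
            u' \<leftarrow> arith (+) u c;
            arith (mod) u' (int l)
          }"
  let ?st = "\<lambda>i. int (horner l (take i cs) x)"
  have body: "runs w (?body (2 + int i) (?st i)) m (?st (Suc i)) m (4 * ?c)" if i: "i < length cs" for i
  proof -
    let ?h = "horner l (take i cs) x"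
    have h: "?h < l" using l by (simp add: horner_less)
    have ci: "cs ! i < l" using cs i nth_mem by blast
    then have ciY: "cs ! i \<le> Y" using lY by linarith
    have "?h * x \<le> l * l" using h l by (intro mult_mono) auto
    then have hx: "int ?h * int x \<le> int l * int l" by (simp flip: of_nat_mult)
    have Y': "2 * (int l * int l) \<le> int Y" using Y by (metis mult.assoc of_nat_le_iff of_nat_mult of_nat_numeral)
    have ll: "int l \<le> int l * int l" using \<open>l * 1 \<le> l * l\<close> by (simp flip: of_nat_mult)
    have b1: "\<bar>int ?h * int x\<bar> \<le> int Y"
      using hx Y' ll by (subst abs_of_nonneg) (simp, linarith)
    have b2: "\<bar>int ?h * int x + int (cs ! i)\<bar> \<le> int Y"
      using hx Y' ll ci by (subst abs_of_nonneg) (simp, linarith)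
    have "runs w (?body (2 + int i) (?st i)) m (?st (Suc i)) m (?c + (?c + (?c + ?c)))"
    proof (intro runs_bind)
      show "runs w (rd R (2 + int i)) m (int (cs ! i)) m ?c"
        using i len w by (intro runs_rd) (auto simp: c nat_add_distrib)
      show "runs w (arith (*) (?st i) (int x)) m (int ?h * int x) m ?c"
        using h l lY by (intro runs_arith) auto
      show "runs w (arith (+) (int ?h * int x) (int (cs ! i))) m (int ?h * int x + int (cs ! i)) m ?c"
        using b1 ciY by (intro runs_arith) auto
      show "runs w (arith (mod) (int ?h * int x + int (cs ! i)) (int l)) m (?st (Suc i)) m ?c"
        using b2 lY i by (intro runs_arith) (auto simp: take_Suc_conv_app_nth horner_snoc zmod_int)
    qed
    then show ?thesis by (rule runs_mono) simp
  qed
  have loop: "runs w (for_loop (length cs) 2 ?body 0) m (int (horner l cs x)) m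
      (length cs * (4 * ?c + 2 * ?c))"
    using runs_for_loop[of "length cs" w ?body 2 ?st "\<lambda>_. m" "4 * ?c" Y] body len l lY
    by simp
  have h: "horner l cs x < l" using l by (simp add: horner_less)
  have "runs w (hash R N (int x)) m (int (hval l b cs x)) m
      (?c + (?c + (length cs * (4 * ?c + 2 * ?c) + (?c + ?c))))"
    unfolding hash_def
  proof (intro runs_bind)
    show "runs w (rd R 0) m (int l) m ?c"
      using w by (intro runs_rd) (auto simp: c)
    show "runs w (rd R 1) m (int b) m ?c"
      using w lY l by (intro runs_rd) (auto simp: c)
    show "runs w (for_loop (nat N) 2 ?body 0) m (int (horner l cs x)) m
      (length cs * (4 * ?c + 2 * ?c))"
      using loop by (simp add: N)
    show "runs w (arith (mod) (int (horner l cs x)) (int b)) m (int (horner l cs x mod b)) m ?c"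
      using h lY l by (intro runs_arith) (auto simp: zmod_int)
    have "horner l cs x mod b < b" using l by simp
    then have "horner l cs x mod b \<le> Y" using lY l by linarith
    then show "runs w (arith (+) (int (horner l cs x mod b)) 1) m (int (hval l b cs x)) m ?c"
      using lY l by (intro runs_arith) (auto simp: hval_def)
  qed
  then show ?thesis by (rule runs_mono) (simp add: algebra_simps)
qed

section \<open>Closed form of the memory after a prefix of the stream\<close>

section \<open>The state of the sketch\<close>

lemma pack_small: "(\<And>x. x \<in> set xs \<Longrightarrow> x < 2 ^ b) \<Longrightarrow> pack b xs = (b, xs)"
  by (simp add: pack_def map_idI)

lemma less_two_power_floorlog: "x \<le> y \<Longrightarrow> 0 < y \<Longrightarrow> x < 2 ^ floorlog 2 y"
  using floorlog_bounds[of y 2] by simp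

text \<open>For a primitive root, \<open>i \<mapsto> g ^ i mod p\<close> is a bijection from
  \<open>{..<p - 1}\<close> to the units, so the description in \<open>dlog\<close> has exactly one
  witness.\<close>

lemma dlog_correct:
  assumes "prime p" "residue_primroot p g" "x \<in> {1..<p}"
  shows "dlog p g x < p - 1" "[g ^ dlog p g x = x] (mod p)"
proof -
  have p1: "p > 1" using assms(1) prime_gt_1_nat by blast
  have bij: "bij_betw (\<lambda>i. g ^ i mod p) {..<p - 1} (totatives p)"
    using residue_primroot_is_generator[OF p1 assms(2)] by (simp add: totient_prime[OF assms(1)])
  have "x \<in> totatives p"
    using assms(1,3) by (auto simp: totatives_prime)
  then have "x \<in> (\<lambda>i. g ^ i mod p) ` {..<p - 1}"
    using bij by (simp add: bij_betw_def)
  then obtain i where i: "i < p - 1" "g ^ i mod p = x"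
    by blast
  have "\<exists>!i. i < p - 1 \<and> [g ^ i = x] (mod p)"
  proof (rule ex1I[of _ i])
    show "i < p - 1 \<and> [g ^ i = x] (mod p)"
      using i by (auto simp: cong_def)
    fix j assume "j < p - 1 \<and> [g ^ j = x] (mod p)"
    then show "j = i"
      using i bij assms(3) by (auto simp: bij_betw_def inj_on_def cong_def)
  qed
  from theI'[OF this] show "dlog p g x < p - 1" "[g ^ dlog p g x = x] (mod p)"
    unfolding dlog_def by auto
qed

lemma log2_ge_1: "2 \<le> k \<Longrightarrow> 1 \<le> log 2 (real k)"
  by simp

lemma par_B_pos: "2 \<le> k \<Longrightarrow> 1 \<le> par_B k"
proof -
  assume "2 \<le> k"
  then have "0 < real k / log 2 (real k)" using log2_ge_1[of k] by simp
  then have "1 \<le> \<lceil>real k / log 2 (real k)\<rceil>" by linarith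
  then show ?thesis unfolding par_B_def by linarith
qed

lemma par_s_eq: "par_s k = 5 * clog k + 24"
  by (simp add: par_s_def par_t_def)

lemma par_C_eq: "par_C k = 4 * (par_s k)\<^sup>2 * par_B k + 1"
  by (simp add: par_C_def par_s_eq)

text \<open>A single run with both seeds fixed, which is deterministic; randomness enters later, by
  counting seeds.\<close>

locale estimator =
  fixes k n M p g l1 l2 :: nat and cs1 cs2 :: "nat list"
  assumes params: "valid_params k n M p g l1 l2"
    and cs1: "cs1 \<in> seeds l1 (par_t k)" and cs2: "cs2 \<in> seeds l2 2"
begin

abbreviation "nB \<equiv> par_B k"
abbreviation "s \<equiv> par_s k"
abbreviation "t \<equiv> par_t k"

definition h1 :: "nat \<Rightarrow> nat" where "h1 = hval l1 nB cs1"
definition h2 :: "nat \<Rightarrow> nat" where "h2 = hval l2 (p - 1) cs2"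

text \<open>Quotient and remainder of the cell index \<open>a\<close> by \<open>2 * s\<close> are
  bucket and power counted from 0, whence \<open>h1 i - 1\<close> and the exponent raised by 1. The
  integer sum is reduced only once, which keeps it visibly linear in the stream.\<close>

definition counter :: "(nat \<times> int) list \<Rightarrow> nat \<Rightarrow> nat" where
  "counter us a = nat ((\<Sum>(i, v)\<leftarrow>us. if h1 i - 1 = a div (2 * s)
     then v * int (h2 i) ^ (a mod (2 * s) + 1) else 0) mod int p)"

definition state :: "(nat \<times> int) list \<Rightarrow> memory" where
  "state us = (init k p g l1 l2 cs1 cs2)
     (Counters := (floorlog 2 p, map (counter us) [0..<nB * (2 * s)]))"

text \<open>A bound on all numbers that occur in the processing of an update.\<close>

definition Y :: nat where "Y = 2 * M * l1\<^sup>2 * l2\<^sup>2 * p\<^sup>2"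

lemma basic: "2 \<le> k" "1 \<le> n" "1 \<le> M" "prime p" "prime l1" "prime l2"
  "n \<le> l1" "nB \<le> l1" "n \<le> l2" "p - 1 \<le> l2" "residue_primroot p g"
  "2 * n \<le> l1" "2 * nB \<le> l1" "2 * n \<le> l2" "2 * (p - 1) \<le> l2"
  "4 * s\<^sup>2 * nB + 1 \<le> p"
  using params by (auto simp: valid_params_def par_C_eq)

lemma pos: "0 < p" "0 < l1" "0 < l2" "0 < nB" "1 < p"
  using basic par_B_pos[of k] prime_gt_0_nat[of p] prime_gt_1_nat[of p]
    prime_gt_0_nat[of l1] prime_gt_0_nat[of l2] by auto

text \<open>\<open>p\<close> exceeds \<open>4 * s\<^sup>2 * nB\<close>, which keeps counter
  addresses, loop bounds and the stored parameters within \<open>p\<close>.\<close>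

lemma small: "s \<ge> 24" "t \<le> s" "nB * (4 * s) < p" "4 * s < p" "nB < p"
proof -
  show s: "s \<ge> 24" "t \<le> s" by (auto simp: par_s_def par_t_def)
  have "nB * (4 * s) * 1 \<le> nB * (4 * s) * s" using s by (intro mult_left_mono) auto
  also have "\<dots> = 4 * s\<^sup>2 * nB" by (simp add: power2_eq_square)
  finally show *: "nB * (4 * s) < p" using basic(16) by linarith
  have "1 * (4 * s) \<le> nB * (4 * s)" using pos by (intro mult_right_mono) auto
  then show "4 * s < p" using * by linarith
  have "nB * 1 \<le> nB * (4 * s)" using s by (intro mult_left_mono) auto
  then show "nB < p" using * by linarith
qed

lemma le_Y: "M \<le> Y" "2 * l1 * l1 \<le> Y" "2 * l2 * l2 \<le> Y" "2 * p * p \<le> Y" "p \<le> Y" "1 \<le> Y"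
proof -
  have ge1: "1 \<le> M" "1 \<le> l1\<^sup>2" "1 \<le> l2\<^sup>2" "1 \<le> p\<^sup>2" using basic pos by auto
  have *: "b \<le> b * c" if "1 \<le> c" for b c :: nat using that by simp
  have Y1: "Y = M * (2 * l1\<^sup>2 * l2\<^sup>2 * p\<^sup>2)" and Y2: "Y = 2 * l1 * l1 * (M * l2\<^sup>2 * p\<^sup>2)"
    and Y3: "Y = 2 * l2 * l2 * (M * l1\<^sup>2 * p\<^sup>2)" and Y4: "Y = 2 * p * p * (M * l1\<^sup>2 * l2\<^sup>2)"
    by (simp_all add: Y_def power2_eq_square)
  have one: "1 \<le> b * c" if "1 \<le> b" "1 \<le> c" for b c :: nat using that by simp
  show "M \<le> Y" unfolding Y1 by (intro * one ge1) simp
  show "2 * l1 * l1 \<le> Y" unfolding Y2 by (intro * one ge1)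
  show "2 * l2 * l2 \<le> Y" unfolding Y3 by (intro * one ge1)
  show Y4: "2 * p * p \<le> Y" unfolding Y4 by (intro * one ge1)
  have "p * 1 \<le> p * p" using pos by (intro mult_left_mono) auto
  then show "p \<le> Y" using Y4 by linarith
  then show "1 \<le> Y" using pos by linarith
qed

lemma h1_bounds: "h1 i \<in> {1..nB}"
  unfolding h1_def by (rule hval_bounds[OF pos(4)])

lemma h2_bounds: "h2 i \<in> {1..<p}"
proof -
  have "h2 i \<in> {1..p - 1}"
    unfolding h2_def by (rule hval_bounds) (use pos in auto)
  then show ?thesis using pos by auto
qed

text \<open>\<open>init\<close> truncates cells to the width of the array. That width is taken from
  an upper bound on all its entries, so nothing is lost; the same argument serves for the tables and
  hash functions below.\<close>

lemma state_Params: "state us Params = (floorlog 2 p, [p, nB, s, t])"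
  using pos small
  by (auto simp: state_def init_def intro!: pack_small less_two_power_floorlog)

lemma state_Counters: "state us Counters = (floorlog 2 p, map (counter us) [0..<nB * (2 * s)])"
  by (simp add: state_def)

lemma state_Table1: "state us Table1 = (floorlog 2 p, map (\<lambda>i. g ^ i mod p) [0..<p - 1])"
  using pos by (auto simp: state_def init_def intro!: pack_small less_two_power_floorlog order.strict_implies_order)

lemma state_Table2: "state us Table2 = (floorlog 2 p, map (dlog p g) [1..<p])"
proof -
  have "dlog p g x < 2 ^ floorlog 2 p" if "x \<in> {1..<p}" for x
    using dlog_correct(1)[OF basic(4) basic(11) that] pos by (intro less_two_power_floorlog) auto
  then show ?thesis
    by (auto simp: state_def init_def intro!: pack_small)
qed

lemma set_cs: "set cs1 \<subseteq> {..<l1}" "set cs2 \<subseteq> {..<l2}" "length cs1 = t" "length cs2 = 2"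
  using cs1 cs2 by (auto simp: seeds_def)

lemma state_Hash1: "state us Hash1 = (floorlog 2 l1, l1 # nB # cs1)"
proof -
  have "x \<le> l1" if "x \<in> set (l1 # nB # cs1)" for x
    using that basic set_cs by auto
  then show ?thesis
    using pos by (auto simp: state_def init_def intro!: pack_small less_two_power_floorlog)
qed

lemma state_Hash2: "state us Hash2 = (floorlog 2 l2, l2 # (p - 1) # cs2)"
proof -
  have "x \<le> l2" if "x \<in> set (l2 # (p - 1) # cs2)" for x
    using that basic set_cs by auto
  then show ?thesis
    using pos by (auto simp: state_def init_def intro!: pack_small less_two_power_floorlog)
qed

lemma state_Nil: "state [] = init k p g l1 l2 cs1 cs2"
proof -
  have "counter [] = (\<lambda>_. 0)" by (simp add: fun_eq_iff counter_def)
  then have "state [] R = init k p g l1 l2 cs1 cs2 R" for R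
    by (cases R) (simp_all add: state_def init_def pack_def map_replicate_const)
  then show ?thesis by blast
qed

section \<open>One stream update: its effect on the counters and its cost\<close>

lemma counter_less: "counter us a < p"
  using pos by (simp add: counter_def nat_less_iff)

lemma counter_snoc:
  "int (counter (us @ [(i, v)]) a) = (int (counter us a) + (if h1 i - 1 = a div (2 * s)
     then v * int (h2 i) ^ (a mod (2 * s) + 1) else 0)) mod int p"
  using pos by (simp add: counter_def mod_simps)

text \<open>By Euler's theorem \<open>g ^ (p - 1)\<close> is 1 modulo \<open>p\<close>, so exponents
  matter modulo \<open>p - 1\<close> only. This is why table lookups can replace exponentiation in
  \<open>update\<close>.\<close>

lemma table_power:
  assumes "x \<in> {1..<p}"
  shows "g ^ (dlog p g x * z mod (p - 1)) mod p = x ^ z mod p"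
proof -
  have "coprime p g"
    using basic(11) by (simp add: residue_primroot_def)
  then have "[g ^ (p - 1) = 1] (mod p)"
    using euler_theorem[of g p] totient_prime[OF basic(4)] by (simp add: coprime_commute)
  have "g ^ (dlog p g x * z) = (g ^ (p - 1)) ^ (dlog p g x * z div (p - 1)) * g ^ (dlog p g x * z mod (p - 1))"
    by (metis mult_div_mod_eq power_add power_mult)
  also have "[\<dots> = 1 ^ (dlog p g x * z div (p - 1)) * g ^ (dlog p g x * z mod (p - 1))] (mod p)"
    by (intro cong_mult cong_pow cong_refl) fact
  finally have "[g ^ (dlog p g x * z mod (p - 1)) = (g ^ dlog p g x) ^ z] (mod p)"
    by (simp add: cong_sym power_mult)
  also have "[(g ^ dlog p g x) ^ z = x ^ z] (mod p)"
    using dlog_correct(2)[OF basic(4) basic(11) assms] by (rule cong_pow)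
  finally show ?thesis by (simp add: cong_def)
qed

text \<open>The operations are \<open>6 * t + 4\<close> for \<open>h1\<close>, 16 for
  \<open>h2\<close>, 12 in each of the \<open>2 * s\<close> rounds (ten in the body, two of loop
  control), and ten others.\<close>

lemma runs_update:
  assumes i: "i \<in> {1..n}" and v: "\<bar>v\<bar> \<le> int M"
  shows "runs w (update (i, v)) (state us) () (state (us @ [(i, v)]))
    ((6 * t + 24 * s + 30) * op_cost w Y)"
proof -
  let ?c = "op_cost w Y"
  define j where "j = h1 i - 1"
  define x where "x = h2 i"
  define e where "e = dlog p g x"
  \<comment> \<open>The loop invariant: after \<open>c\<close> rounds the first \<open>c\<close>
    counters of bucket \<open>j\<close> have their new values and all others their old ones.\<close>
  define mem where "mem c = (state us)(Counters := (floorlog 2 p,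
     map (\<lambda>a. if a div (2 * s) = j \<and> a mod (2 * s) < c then counter (us @ [(i, v)]) a else counter us a)
       [0..<nB * (2 * s)]))" for c
  have x: "x \<in> {1..<p}" unfolding x_def by (rule h2_bounds)
  have j: "h1 i = j + 1" "j < nB"
    using h1_bounds[of i] by (auto simp: j_def)
  have e: "e < p - 1"
    unfolding e_def by (rule dlog_correct[OF basic(4) basic(11) x])
  have s0: "0 < s" using small by simp
  have w_p: "floorlog 2 p \<le> floorlog 2 Y" using le_Y by (simp add: floorlog_mono)
  have pY: "int p \<le> int Y" "2 * (int p * int p) \<le> int Y"
    using le_Y(4,5) by (simp_all add: mult.assoc flip: of_nat_mult)
  have pp: "int p \<le> int p * int p"
  proof -
    have "int p * 1 \<le> int p * int p" using pos by (intro mult_left_mono) auto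
    then show ?thesis by simp
  qed
  have ik: "i \<le> l1" "i \<le> l2" using i basic by auto
  let ?v = "v mod int p"
  have v': "0 \<le> ?v" "?v < int p" "\<bar>?v\<bar> \<le> int p" using pos by (auto simp: order.strict_implies_order)
  let ?body = "\<lambda>z (_::unit). do {
       ez \<leftarrow> arith (*) (int e) z;
       ez' \<leftarrow> arith (mod) ez (int p - 1);
       y \<leftarrow> rd Table1 ez';
       d \<leftarrow> arith (*) ?v y;
       z' \<leftarrow> arith (-) z 1;
       a \<leftarrow> arith (+) (int j * (2 * int s)) z';
       X \<leftarrow> rd Counters a;
       X' \<leftarrow> arith (+) X d;
       X'' \<leftarrow> arith (mod) X' (int p);
       wr Counters a X''
     }"
  have body: "runs w (?body (1 + int c) ()) (mem c) () (mem (Suc c)) (10 * ?c)" if c: "c < 2 * s" for c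
  proof -
    define a where "a = j * (2 * s) + c"
    define y where "y = x ^ (c + 1) mod p"
    have a: "a < nB * (2 * s)" "a div (2 * s) = j" "a mod (2 * s) = c"
    proof -
      have "a < (j + 1) * (2 * s)" using c by (simp add: a_def)
      also have "\<dots> \<le> nB * (2 * s)" using j by (intro mult_right_mono) auto
      finally show "a < nB * (2 * s)" .
      show "a div (2 * s) = j" "a mod (2 * s) = c"
        using c s0 by (simp_all add: a_def)
    qed
    have aY: "int a \<le> int Y" using a small(3) pY by (simp add: algebra_simps)
    have cp: "1 + int c < int p" using c small(4) by linarith
    have mem_T: "mem c Table1 = (floorlog 2 p, map (\<lambda>i. g ^ i mod p) [0..<p - 1])"
      by (simp add: mem_def state_Table1)
    have mem_C: "width (mem c) Counters = floorlog 2 p" "cells (mem c) Counters ! a = counter us a"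
      using a by (auto simp: mem_def width_def cells_def)
    have ez: "int e * (1 + int c) \<le> int p * int p"
      using e cp by (intro mult_mono) auto
    have y: "y < p" unfolding y_def using pos by simp
    have d: "?v * int y \<le> int p * int p" "0 \<le> ?v * int y"
      using v' y by (intro mult_mono, auto simp del: pos_mod_bound)
    have X: "counter us a < p" by (rule counter_less)
    have XY: "\<bar>int (counter us a) + ?v * int y\<bar> \<le> int Y"
      using X d pY pp by linarith
    have X'': "(int (counter us a) + ?v * int y) mod int p = int (counter (us @ [(i, v)]) a)"
    proof -
      have "(int (counter us a) + ?v * int y) mod int p
          = (int (counter us a) + v * int x ^ (c + 1)) mod int p"
        by (simp only: y_def zmod_int of_nat_power mod_add_right_eq mod_mult_eq
            flip: mod_add_right_eq[of "int (counter us a)" "v mod int p * _"])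
      then show ?thesis using a j by (simp only: counter_snoc x_def) simp
    qed
    have upd: "mem (Suc c) = (mem c)(Counters := (width (mem c) Counters, (cells (mem c) Counters)
        [nat (int a) := nat (int (counter (us @ [(i, v)]) a) mod 2 ^ width (mem c) Counters)]))"
    proof -
      have "counter (us @ [(i, v)]) a < 2 ^ floorlog 2 p"
        using counter_less[of "us @ [(i, v)]" a] pos by (intro less_two_power_floorlog) auto
      then have "nat (int (counter (us @ [(i, v)]) a) mod 2 ^ floorlog 2 p) = counter (us @ [(i, v)]) a"
        by (simp add: nat_mod_distrib nat_power_eq)
      \<comment> \<open>Passing from \<open>c\<close> to \<open>Suc c\<close> changes exactly the
        cell \<open>a\<close>, which is \<open>j * (2 * s) + c\<close>.\<close>
      moreover have "(b div (2 * s) = j \<and> b mod (2 * s) < Suc c) \<longleftrightarrow>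
          b = a \<or> (b div (2 * s) = j \<and> b mod (2 * s) < c)" for b
        using a div_mult_mod_eq[of b "2 * s"] by (auto simp: a_def less_Suc_eq)
      ultimately show ?thesis
        using a by (auto simp: mem_def width_def cells_def nth_list_update intro!: arg_cong[where f = "fun_upd _ _"] nth_equalityI)
    qed
    have "runs w (?body (1 + int c) ()) (mem c) () (mem (Suc c))
        (?c + (?c + (?c + (?c + (?c + (?c + (?c + (?c + (?c + ?c)))))))))"
    proof (intro runs_bind)
      show "runs w (arith (*) (int e) (1 + int c)) (mem c) (int (e * (c + 1))) (mem c) ?c"
        using e cp pY by (intro runs_arith) (auto simp: algebra_simps)
      have ez': "int (e * (c + 1)) \<le> int p * int p" using ez by (simp add: algebra_simps)
      show "runs w (arith (mod) (int (e * (c + 1))) (int p - 1)) (mem c)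
          (int (e * (c + 1) mod (p - 1))) (mem c) ?c"
      proof (rule runs_arith)
        show "\<bar>int (e * (c + 1))\<bar> \<le> int Y" using ez' pY by linarith
        show "\<bar>int p - 1\<bar> \<le> int Y" using pY pos by linarith
        show "int (e * (c + 1)) mod (int p - 1) = int (e * (c + 1) mod (p - 1))"
          using pos by (simp add: zmod_int of_nat_diff)
      qed
      have ep: "e * (c + 1) mod (p - 1) < p - 1" using pos by simp
      show "runs w (rd Table1 (int (e * (c + 1) mod (p - 1)))) (mem c) (int y) (mem c) ?c"
      proof (rule runs_rd)
        show "\<bar>int (e * (c + 1) mod (p - 1))\<bar> \<le> int Y" using ep pY by linarith
        show "width (mem c) Table1 \<le> floorlog 2 Y" using w_p by (simp add: width_def mem_T)
        have "cells (mem c) Table1 ! (e * (c + 1) mod (p - 1)) = g ^ (e * (c + 1) mod (p - 1)) mod p"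
          using ep by (simp add: cells_def mem_T)
        also have "\<dots> = y" unfolding e_def y_def by (rule table_power[OF x])
        finally show "int (cells (mem c) Table1 ! nat (int (e * (c + 1) mod (p - 1)))) = int y" by simp
      qed
      show "runs w (arith (*) ?v (int y)) (mem c) (?v * int y) (mem c) ?c"
        using v' y pY by (intro runs_arith) (linarith | simp)+
      show "runs w (arith (-) (1 + int c) 1) (mem c) (int c) (mem c) ?c"
        using cp pY pos by (intro runs_arith) auto
      show "runs w (arith (+) (int j * (2 * int s)) (int c)) (mem c) (int a) (mem c) ?c"
        using aY cp pY by (intro runs_arith) (auto simp: a_def)
      show "runs w (rd Counters (int a)) (mem c) (int (counter us a)) (mem c) ?c"
        using aY mem_C w_p by (intro runs_rd) auto
      show "runs w (arith (+) (int (counter us a)) (?v * int y)) (mem c)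
          (int (counter us a) + ?v * int y) (mem c) ?c"
        using X d pY pp by (intro runs_arith) (linarith | simp)+
      show "runs w (arith (mod) (int (counter us a) + ?v * int y) (int p)) (mem c)
          (int (counter (us @ [(i, v)]) a)) (mem c) ?c"
        using XY pY X'' by (intro runs_arith) auto
      show "runs w (wr Counters (int a) (int (counter (us @ [(i, v)]) a))) (mem c) () (mem (Suc c)) ?c"
        using aY mem_C w_p upd by (intro runs_wr) auto
    qed
    then show ?thesis by (rule runs_mono) simp
  qed
  have "runs w (for_loop (2 * s) 1 ?body ()) (mem 0) () (mem (2 * s)) (2 * s * (10 * ?c + 2 * ?c))"
    using runs_for_loop[of "2 * s" w ?body 1 "\<lambda>_. ()" mem "10 * ?c" Y] body small(4) le_Y by auto
  moreover have "mem 0 = state us"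
    by (simp add: mem_def flip: state_Counters)
  \<comment> \<open>After \<open>2 * s\<close> rounds all of bucket \<open>j\<close> is new, and a
    counter of another bucket has the same value with and without the update.\<close>
  moreover have "mem (2 * s) = state (us @ [(i, v)])"
  proof -
    have "counter us a = counter (us @ [(i, v)]) a" if "a div (2 * s) \<noteq> j" for a
      using counter_snoc[of us i v a] that j counter_less[of us a] by simp
    then show ?thesis
      using s0 by (auto simp: mem_def state_def)
  qed
  ultimately have loop: "runs w (for_loop (2 * s) 1 ?body ()) (state us) () (state (us @ [(i, v)]))
      (2 * s * (10 * ?c + 2 * ?c))"
    by simp
  have "runs w (update (i, v)) (state us) () (state (us @ [(i, v)]))
    (?c + (?c + (?c + ((6 * length cs1 + 4) * ?c + ((6 * length cs2 + 4) * ?c +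
       (?c + (?c + (?c + (?c + (?c + (?c + (?c + (2 * s * (10 * ?c + 2 * ?c))))))))))))))"
    unfolding update_def Let_def fst_conv snd_conv
  proof (intro runs_bind)
    have wP: "width (state us) Params \<le> floorlog 2 Y" using w_p by (simp add: width_def state_Params)
    have cP: "cells (state us) Params = [p, nB, s, t]" by (simp add: cells_def state_Params)
    show "runs w (rd Params 0) (state us) (int p) (state us) ?c"
      using wP by (intro runs_rd) (auto simp: cP)
    have Y4: "4 \<le> int Y" using pY small by linarith
    show "runs w (rd Params 2) (state us) (int s) (state us) ?c"
      using wP Y4 by (intro runs_rd) (auto simp: cP)
    show "runs w (rd Params 3) (state us) (int t) (state us) ?c"
      using wP Y4 by (intro runs_rd) (auto simp: cP)
    show "runs w (hash Hash1 (int t) (int i)) (state us) (int (h1 i)) (state us)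
        ((6 * length cs1 + 4) * ?c)"
      unfolding h1_def using pos basic ik set_cs small le_Y
      by (intro runs_hash state_Hash1) auto
    show "runs w (hash Hash2 2 (int i)) (state us) (int x) (state us) ((6 * length cs2 + 4) * ?c)"
      unfolding h2_def x_def using pos basic ik set_cs small le_Y Y4
      by (intro runs_hash state_Hash2) auto
    show "runs w (arith (mod) v (int p)) (state us) ?v (state us) ?c"
      using v le_Y(1) pY by (intro runs_arith) auto
    show "runs w (arith (-) (int x) 1) (state us) (int x - 1) (state us) ?c"
      using x pY by (intro runs_arith) auto
    show "runs w (rd Table2 (int x - 1)) (state us) (int e) (state us) ?c"
    proof (rule runs_rd)
      show "\<bar>int x - 1\<bar> \<le> int Y" using x pY by auto
      show "width (state us) Table2 \<le> floorlog 2 Y" using w_p by (simp add: width_def state_Table2)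
      show "int (cells (state us) Table2 ! nat (int x - 1)) = int e"
        using x by (auto simp: cells_def state_Table2 e_def nat_diff_distrib)
    qed
    show "runs w (arith (-) (int p) 1) (state us) (int p - 1) (state us) ?c"
      using Y4 pY by (intro runs_arith) auto
    show "runs w (arith (*) 2 (int s)) (state us) (2 * int s) (state us) ?c"
      using Y4 pY small by (intro runs_arith) auto
    have "int (h1 i) \<le> int Y" using h1_bounds[of i] small pY by auto
    then show "runs w (arith (-) (int (h1 i)) 1) (state us) (int j) (state us) ?c"
      using Y4 j by (intro runs_arith) auto
    show "runs w (arith (*) (int j) (2 * int s)) (state us) (int j * (2 * int s)) (state us) ?c"
      using Y4 pY small j by (intro runs_arith) auto
    show "runs w (for_loop (nat (2 * int s)) 1 ?body ()) (state us) () (state (us @ [(i, v)]))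
       (2 * s * (10 * ?c + 2 * ?c))"
      using loop by (simp add: nat_mult_distrib)
  qed
  then show ?thesis
    by (rule runs_mono) (simp add: set_cs algebra_simps)
qed

lemma update_state:
  assumes "i \<in> {1..n}" "\<bar>v\<bar> \<le> int M"
  shows "fst (snd (update (i, v) w (state us))) = state (us @ [(i, v)])"
    and "update_time w (i, v) (state us) \<le> (6 * t + 24 * s + 30) * op_cost w Y"
  using runs_update[OF assms, of w us] by (auto simp: runs_def update_time_def)

lemma process_state:
  assumes "\<forall>(i, v)\<in>set us. i \<in> {1..n} \<and> \<bar>v\<bar> \<le> int M"
  shows "process w us (init k p g l1 l2 cs1 cs2) = state us"
  using assms
proof (induction us rule: rev_induct)
  case Nil
  then show ?case by (simp add: process_def state_Nil)
next
  case (snoc u us)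
  obtain i v where [simp]: "u = (i, v)" by (cases u)
  have "process w (us @ [u]) (init k p g l1 l2 cs1 cs2)
      = fst (snd (update u w (process w us (init k p g l1 l2 cs1 cs2))))"
    by (simp add: process_def)
  also have "\<dots> = state (us @ [u])"
    using snoc by (simp add: update_state(1))
  finally show ?case .
qed

end

section \<open>From power sums modulo \<open>p\<close> back to frequencies\<close>

section \<open>Decoding\<close>

text \<open>Such an \<open>f\<close> is the representative of its residue class nearest to 0, and
  \<open>sigma\<close> picks that one: for negative \<open>f\<close> the residue
  \<open>f + p\<close> exceeds \<open>p / 2\<close>.\<close>

lemma sigma_mod:
  assumes "2 * \<bar>f\<bar> < int p"
  shows "sigma p (nat (f mod int p)) = f"
proof (cases "f \<ge> 0")
  case True
  then show ?thesis using assms by (simp add: sigma_def)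
next
  case False
  have "f mod int p = (f + int p) mod int p" by simp
  also have "\<dots> = f + int p" using False assms by (intro mod_pos_pos_trivial) auto
  finally have "f mod int p = f + int p" .
  moreover have "\<not> real (nat (f + int p)) \<le> real p / 2"
  proof -
    have "real (nat (f + int p)) = real_of_int (f + int p)" using False assms by simp
    moreover have "real_of_int (int p) < real_of_int (2 * (f + int p))"
      using False assms by (subst of_int_less_iff) simp
    ultimately show ?thesis by simp
  qed
  ultimately show ?thesis using False assms by (simp add: sigma_def)
qed

lemma freq_Cons: "freq ((i, v) # us) j = (if i = j then v else 0) + freq us j"
  by (simp add: freq_def)

text \<open>Linearity: the updates are grouped by index. \<open>P\<close> will select a bucket, and
  \<open>F\<close> will be a power of the second hash value.\<close>

lemma sum_list_updates_eq_sum_freq: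
  fixes F :: "nat \<Rightarrow> int"
  assumes "\<forall>(i, v)\<in>set us. i \<in> {1..n}"
  shows "(\<Sum>(i, v)\<leftarrow>us. if P i then v * F i else 0) = (\<Sum>i\<in>{i\<in>{1..n}. P i}. freq us i * F i)"
  using assms
proof (induction us)
  case Nil
  then show ?case by (simp add: freq_def)
next
  case (Cons u us)
  obtain i v where u: "u = (i, v)" by (cases u)
  have "(\<Sum>j\<in>{j\<in>{1..n}. P j}. freq (u # us) j * F j)
     = (\<Sum>j\<in>{j\<in>{1..n}. P j}. (if i = j then v * F j else 0) + freq us j * F j)"
    by (intro sum.cong) (auto simp: u freq_Cons algebra_simps)
  also have "\<dots> = (if P i then v * F i else 0) + (\<Sum>j\<in>{j\<in>{1..n}. P j}. freq us j * F j)"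
    using Cons.prems by (auto simp: u sum.distrib)
  finally show ?case using Cons by (simp add: u)
qed

lemma real_k_le_par_B: "2 \<le> k \<Longrightarrow> real k \<le> log 2 (real k) * real (par_B k)"
proof -
  assume k: "2 \<le> k"
  have "real k / log 2 (real k) \<le> real (par_B k)"
    unfolding par_B_def by (rule real_nat_ceiling_ge)
  then show ?thesis using log2_ge_1[OF k] by (simp add: field_simps)
qed

lemma log_le_clog: "log 2 (real k) \<le> real (clog k)"
  unfolding clog_def by (rule real_nat_ceiling_ge)

context estimator begin

definition bucket :: "(nat \<times> int) list \<Rightarrow> nat \<Rightarrow> nat list" where
  "bucket us j = map (\<lambda>z. counter us ((j - 1) * (2 * s) + (z - 1))) [1..<2 * s + 1]"

lemma recovered_state:
  assumes "j \<in> {1..nB}"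
  shows "recovered dec (state us) j = dec p s (bucket us j)"
proof -
  have "j * (2 * s) \<le> nB * (2 * s)" using assms by (intro mult_right_mono) auto
  then have le: "(j - 1) * (2 * s) + 2 * s \<le> nB * (2 * s)"
    using assms by (cases j) auto
  define J where "J = (j - 1) * (2 * s)"
  define N where "N = nB * (2 * s)"
  have "take (2 * s) (drop J (map (counter us) [0..<N])) = bucket us j"
    using le unfolding J_def[symmetric] N_def[symmetric] bucket_def
    by (intro nth_equalityI) (auto simp del: upt_Suc)
  then show ?thesis
    by (simp add: recovered_def state_Params state_Counters cells_def Let_def J_def N_def)
qed

lemma bucket_props: "length (bucket us j) = 2 * s" "set (bucket us j) \<subseteq> {..<p}"
  using counter_less by (auto simp: bucket_def)

text \<open>Only the last fact presupposes an \<open>s\<close>-sparse vector behind the power sums;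
  the others also cover overloaded buckets, for which space has to be bounded as well.\<close>

lemma recovered_props:
  assumes "sparse_recovery D dec" "dec p s (bucket us j) = (out, ops)"
  shows "length out \<le> s" "distinct (map fst out)" "set out \<subseteq> {1..<p} \<times> {1..<p}"
    "real ops \<le> D * ((real s)\<^sup>2
             + real s * log 2 (real s) * log 2 (log 2 (real s)) * log 2 (real p))"
    "\<And>r. \<lbrakk>\<forall>x\<in>{1..<p}. r x < p; card {x\<in>{1..<p}. r x \<noteq> 0} \<le> s; bucket us j = power_sums p s r\<rbrakk>
       \<Longrightarrow> set out = {(x, r x) |x. x \<in> {1..<p} \<and> r x \<noteq> 0}"
proof -
  have "prime p \<and> 3 \<le> s \<and> 2 * s + 1 < p \<and> length (bucket us j) = 2 * s \<and> set (bucket us j) \<subseteq> {..<p}"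
    using basic small bucket_props by auto
  from assms(1)[unfolded sparse_recovery_def, rule_format, OF this, unfolded assms(2) prod.case]
  show "length out \<le> s" "distinct (map fst out)" "set out \<subseteq> {1..<p} \<times> {1..<p}"
    "real ops \<le> D * ((real s)\<^sup>2
             + real s * log 2 (real s) * log 2 (log 2 (real s)) * log 2 (real p))"
    "\<And>r. \<lbrakk>\<forall>x\<in>{1..<p}. r x < p; card {x\<in>{1..<p}. r x \<noteq> 0} \<le> s; bucket us j = power_sums p s r\<rbrakk>
       \<Longrightarrow> set out = {(x, r x) |x. x \<in> {1..<p} \<and> r x \<noteq> 0}"
    by blast+
qed

lemma counter_eq_sum_freq:
  assumes "\<forall>(i, v)\<in>set us. i \<in> {1..n}" "1 \<le> j" "z < 2 * s"
  shows "int (counter us ((j - 1) * (2 * s) + z))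
    = (\<Sum>i\<in>{i\<in>{1..n}. h1 i = j}. freq us i * int (h2 i) ^ (z + 1)) mod int p"
proof -
  have "((j - 1) * (2 * s) + z) div (2 * s) = j - 1" "((j - 1) * (2 * s) + z) mod (2 * s) = z"
    using assms(3) by simp_all
  moreover have "h1 i - 1 = j - 1 \<longleftrightarrow> h1 i = j" for i
    using h1_bounds[of i] assms(2) by auto
  ultimately have "int (counter us ((j - 1) * (2 * s) + z))
      = (\<Sum>(i, v)\<leftarrow>us. if h1 i = j then v * int (h2 i) ^ (z + 1) else 0) mod int p"
    using pos by (simp only: counter_def) simp
  then show ?thesis
    by (simp only: sum_list_updates_eq_sum_freq[OF assms(1), of "\<lambda>i. h1 i = j" "\<lambda>i. int (h2 i) ^ (z + 1)"])
qed

text \<open>\<open>k\<close> is at most \<open>clog k * nB\<close>, which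
  \<open>s\<^sup>2 * nB\<close> dominates. Frequencies of absolute value at most \<open>k\<close>
  can therefore be read off their residues by \<open>sigma\<close>.\<close>

lemma two_k_less_p: "2 * k < p"
proof -
  have "real k \<le> real (clog k) * real nB"
    using real_k_le_par_B[OF basic(1)] mult_right_mono[OF log_le_clog, of "real nB" k] by simp
  then have "k \<le> clog k * nB" by (simp flip: of_nat_mult)
  also have "\<dots> \<le> s * nB" by (intro mult_right_mono) (auto simp: par_s_eq)
  also have "\<dots> \<le> s\<^sup>2 * nB" by (intro mult_right_mono) (auto simp: power2_eq_square)
  finally show ?thesis using basic(16) by linarith
qed

text \<open>Transporting the frequencies along \<open>h2\<close>, which is injective on
  \<open>S\<close>, gives a vector with at most \<open>s\<close> nonzero entries whose power sums
  are the counters. The decoder must return this vector, and \<open>sigma\<close> undoes the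
  reduction modulo \<open>p\<close>.\<close>

lemma bucket_decoded:
  assumes dec: "sparse_recovery D dec" and us: "\<forall>(i, v)\<in>set us. i \<in> {1..n}" and "1 \<le> j"
    and S: "S = {i\<in>{1..n}. h1 i = j \<and> freq us i \<noteq> 0}"
    and fp: "\<And>i. i \<in> S \<Longrightarrow> 2 * \<bar>freq us i\<bar> < int p"
    and load: "card S \<le> s" and inj: "inj_on h2 S"
  shows "(\<Sum>(x, y)\<leftarrow>fst (dec p s (bucket us j)). \<bar>sigma p y\<bar>) = (\<Sum>i\<in>S. \<bar>freq us i\<bar>)"
proof -
  obtain out ops where out: "dec p s (bucket us j) = (out, ops)" by fastforce
  define f where "f i = nat (freq us i mod int p)" for i
  \<comment> \<open>By injectivity, \<open>inv_into S h2 x\<close> is the only index of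
    \<open>S\<close> with second hash value \<open>x\<close>.\<close>
  define r where "r x = (if x \<in> h2 ` S then f (inv_into S h2 x) else 0)" for x
  have fin: "finite S" unfolding S by simp
  have r_h2: "r (h2 i) = f i" if "i \<in> S" for i
    using that inj by (simp add: r_def)
  have r_0: "r x = 0" if "x \<notin> h2 ` S" for x
    using that by (simp add: r_def)
  \<comment> \<open>An absolute value below \<open>p\<close> keeps a nonzero frequency nonzero
    modulo \<open>p\<close>, so no index of \<open>S\<close> drops out of the support of
    \<open>r\<close>.\<close>
  have f0: "f i \<noteq> 0" if "i \<in> S" for i
  proof -
    have "freq us i \<noteq> 0" using that by (simp add: S)
    then have "\<not> int p dvd freq us i"
      using fp[OF that] dvd_imp_le_int[of "freq us i" "int p"] by auto
    then have "freq us i mod int p \<noteq> 0" by (simp add: dvd_eq_mod_eq_0)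
    moreover have "0 \<le> freq us i mod int p" using pos by simp
    ultimately show ?thesis unfolding f_def by linarith
  qed
  have sub: "h2 ` S \<subseteq> {1..<p}" using h2_bounds by auto
  have "power_sums p s r = bucket us j"
  proof (rule nth_equalityI)
    fix z assume "z < length (power_sums p s r)"
    then have z: "z < 2 * s" by (simp add: power_sums_def del: upt_Suc)
    have "(\<Sum>x\<in>{1..<p}. r x * x ^ (z + 1)) = (\<Sum>x\<in>h2 ` S. r x * x ^ (z + 1))"
      using sub r_0 by (intro sum.mono_neutral_right) auto
    also have "\<dots> = (\<Sum>i\<in>S. f i * h2 i ^ (z + 1))"
      using inj r_h2 by (subst sum.reindex) (auto simp: r_h2)
    finally have "int ((\<Sum>x\<in>{1..<p}. r x * x ^ (z + 1)) mod p)
        = (\<Sum>i\<in>S. (freq us i mod int p) * int (h2 i) ^ (z + 1)) mod int p"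
      using pos by (simp add: zmod_int f_def)
    also have "\<dots> = (\<Sum>i\<in>S. ((freq us i mod int p) * int (h2 i) ^ (z + 1)) mod int p) mod int p"
      by (simp only: mod_sum_eq)
    also have "\<dots> = (\<Sum>i\<in>S. (freq us i * int (h2 i) ^ (z + 1)) mod int p) mod int p"
      by (simp only: mod_mult_left_eq)
    also have "\<dots> = (\<Sum>i\<in>S. freq us i * int (h2 i) ^ (z + 1)) mod int p"
      by (simp only: mod_sum_eq)
    \<comment> \<open>Indices of the bucket with frequency 0 re-enter the sum without
      contributing.\<close>
    also have "(\<Sum>i\<in>S. freq us i * int (h2 i) ^ (z + 1))
        = (\<Sum>i\<in>{i\<in>{1..n}. h1 i = j}. freq us i * int (h2 i) ^ (z + 1))"
      by (rule sum.mono_neutral_left) (auto simp: S)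
    also have "\<dots> mod int p = int (counter us ((j - 1) * (2 * s) + z))"
      using counter_eq_sum_freq[OF us \<open>1 \<le> j\<close> z] by simp
    finally show "power_sums p s r ! z = bucket us j ! z"
      using z by (simp add: power_sums_def bucket_def del: upt_Suc)
  qed (simp add: power_sums_def bucket_def del: upt_Suc)
  then have "bucket us j = power_sums p s r" ..
  moreover have "\<forall>x\<in>{1..<p}. r x < p"
    using pos by (auto simp: r_def f_def nat_less_iff)
  moreover have supp: "{x\<in>{1..<p}. r x \<noteq> 0} = h2 ` S"
  proof -
    have "r x \<noteq> 0 \<longleftrightarrow> x \<in> h2 ` S" for x
      using r_0[of x] r_h2 f0 by (cases "x \<in> h2 ` S") auto
    then show ?thesis using sub by blast
  qed
  moreover have "card {x\<in>{1..<p}. r x \<noteq> 0} \<le> s"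
    unfolding supp using load card_image_le[OF fin, of h2] by linarith
  ultimately have set_out: "set out = {(x, r x) |x. x \<in> {1..<p} \<and> r x \<noteq> 0}"
    by (intro recovered_props(5)[OF dec out])
  also have "\<dots> = (\<lambda>i. (h2 i, f i)) ` S"
  proof -
    have "{(x, r x) |x. x \<in> {1..<p} \<and> r x \<noteq> 0} = (\<lambda>x. (x, r x)) ` {x\<in>{1..<p}. r x \<noteq> 0}"
      by blast
    also have "\<dots> = (\<lambda>i. (h2 i, r (h2 i))) ` S"
      using supp by (simp only: image_image)
    also have "\<dots> = (\<lambda>i. (h2 i, f i)) ` S"
      by (intro image_cong refl) (simp add: r_h2)
    finally show ?thesis .
  qed
  finally have set_out: "set out = (\<lambda>i. (h2 i, f i)) ` S" .
  have "distinct out"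
    using recovered_props(2)[OF dec out] by (simp add: distinct_map)
  then have "(\<Sum>(x, y)\<leftarrow>out. \<bar>sigma p y\<bar>) = (\<Sum>(x, y)\<in>set out. \<bar>sigma p y\<bar>)"
    by (rule sum_list_distinct_conv_sum_set)
  also have "\<dots> = (\<Sum>i\<in>S. \<bar>sigma p (f i)\<bar>)"
    unfolding set_out using inj by (subst sum.reindex) (auto simp: inj_on_def)
  also have "\<dots> = (\<Sum>i\<in>S. \<bar>freq us i\<bar>)"
    using fp by (intro sum.cong) (auto simp: f_def sigma_mod)
  finally show ?thesis by (simp add: out)
qed

lemma report_state:
  "report dec (state us) = (\<Sum>j = 1..nB. \<Sum>(x, y)\<leftarrow>fst (dec p s (bucket us j)). \<bar>sigma p y\<bar>)"
proof -
  have "cells (state us) Params = [p, nB, s, t]" by (simp add: cells_def state_Params)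
  then have "report dec (state us)
      = (\<Sum>j = 1..nB. \<Sum>(x, y)\<leftarrow>fst (recovered dec (state us) j). \<bar>sigma p y\<bar>)"
    by (simp add: report_def)
  also have "\<dots> = (\<Sum>j = 1..nB. \<Sum>(x, y)\<leftarrow>fst (dec p s (bucket us j)). \<bar>sigma p y\<bar>)"
    by (rule sum.cong[OF refl]) (simp only: recovered_state)
  finally show ?thesis .
qed

text \<open>The deterministic core of exactness: every bucket is decoded correctly, and since
  \<open>h1\<close> partitions the indices into buckets, the bucket sums add up to
  \<open>L1\<close>.\<close>

lemma report_correct:
  assumes dec: "sparse_recovery D dec" and us: "\<forall>(i, v)\<in>set us. i \<in> {1..n}"
    and L1: "L1 n us \<le> int k"
    and load: "\<And>j. j \<in> {1..nB} \<Longrightarrow> card {i\<in>{1..n}. h1 i = j \<and> freq us i \<noteq> 0} \<le> s"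
    and inj: "\<And>j. j \<in> {1..nB} \<Longrightarrow> inj_on h2 {i\<in>{1..n}. h1 i = j \<and> freq us i \<noteq> 0}"
  shows "report dec (state us) = L1 n us"
proof -
  have fp: "2 * \<bar>freq us i\<bar> < int p" if "i \<in> {1..n}" for i
  proof -
    have "\<bar>freq us i\<bar> \<le> L1 n us"
      unfolding L1_def using that by (intro member_le_sum) auto
    then show ?thesis using L1 two_k_less_p by linarith
  qed
  have "report dec (state us)
      = (\<Sum>j\<in>{1..nB}. \<Sum>i\<in>{i\<in>{1..n}. h1 i = j \<and> freq us i \<noteq> 0}. \<bar>freq us i\<bar>)"
    unfolding report_state
  proof (rule sum.cong[OF refl])
    fix j assume j: "j \<in> {1..nB}"
    show "(\<Sum>(x, y)\<leftarrow>fst (dec p s (bucket us j)). \<bar>sigma p y\<bar>)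
        = (\<Sum>i\<in>{i\<in>{1..n}. h1 i = j \<and> freq us i \<noteq> 0}. \<bar>freq us i\<bar>)"
      by (rule bucket_decoded[OF dec us _ refl _ load[OF j] inj[OF j]]) (use j fp in auto)
  qed
  also have "\<dots> = (\<Sum>j\<in>{1..nB}. \<Sum>i\<in>{i\<in>{1..n}. h1 i = j}. \<bar>freq us i\<bar>)"
    by (rule sum.cong[OF refl], rule sum.mono_neutral_left) auto
  also have "\<dots> = L1 n us"
    unfolding L1_def by (rule sum.group) (use h1_bounds in auto)
  finally show ?thesis .
qed

end

section \<open>Counting the seeds that overload a bucket or cause a collision\<close>

section \<open>Failure probability\<close>

text \<open>The right-hand side is the product of the numbers from \<open>m + 1\<close> to
  \<open>m + t\<close>, each at least \<open>m\<close>.\<close>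

lemma power_le_fact_times_binomial: "m ^ t \<le> fact t * ((m + t) choose t)"
proof (induction t)
  case (Suc t)
  have "m ^ Suc t \<le> Suc (m + t) * (fact t * ((m + t) choose t))"
    using Suc by (simp only: power_Suc) (intro mult_mono, auto)
  also have "\<dots> = fact (Suc t) * ((m + Suc t) choose Suc t)"
    using Suc_times_binomial_eq[of "m + t" t] by (simp only: fact_Suc add_Suc_right mult_ac of_nat_id)
  finally show ?case .
qed simp

text \<open>Double counting of the pairs of a seed and an \<open>m\<close>-subset of the bucket \<open>j\<close>.\<close>

lemma card_overloaded_times_binomial_le:
  assumes "prime l" "finite S" "S \<subseteq> {..<l}" "b > 0" "2 * b \<le> l"
  shows "real (card {cs \<in> seeds l m. r < card {i\<in>S. hval l b cs i = j}}) * real (Suc r choose m)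
    \<le> real (card S choose m) * (3 / 2 * (real l / real b)) ^ m"
proof -
  let ?load = "\<lambda>cs. {i\<in>S. hval l b cs i = j}"
  let ?TT = "{T. T \<subseteq> S \<and> card T = m}"
  have fTT: "finite ?TT" using assms(2) by simp
  have "card {cs \<in> seeds l m. r < card (?load cs)} * (Suc r choose m)
      = (\<Sum>cs\<in>{cs \<in> seeds l m. r < card (?load cs)}. (Suc r choose m))"
    by simp
  \<comment> \<open>A bucket with more than \<open>r\<close> elements has at least
    \<open>Suc r choose m\<close> subsets of size \<open>m\<close>.\<close>
  also have "\<dots> \<le> (\<Sum>cs\<in>{cs \<in> seeds l m. r < card (?load cs)}. (card (?load cs) choose m))"
    by (intro sum_mono binomial_right_mono) auto
  also have "\<dots> \<le> (\<Sum>cs\<in>seeds l m. (card (?load cs) choose m))"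
    by (intro sum_mono2) auto
  also have "\<dots> = (\<Sum>cs\<in>seeds l m. card {T\<in>?TT. \<forall>x\<in>T. hval l b cs x = j})"
  proof (rule sum.cong[OF refl])
    fix cs
    have "{T\<in>?TT. \<forall>x\<in>T. hval l b cs x = j} = {T. T \<subseteq> ?load cs \<and> card T = m}" by auto
    then show "(card (?load cs) choose m) = card {T\<in>?TT. \<forall>x\<in>T. hval l b cs x = j}"
      using assms(2) by (simp add: n_subsets)
  qed
  also have "\<dots> = (\<Sum>cs\<in>seeds l m. \<Sum>T\<in>?TT. of_bool (\<forall>x\<in>T. hval l b cs x = j))"
    using fTT by (simp add: Int_def)
  also have "\<dots> = (\<Sum>T\<in>?TT. \<Sum>cs\<in>seeds l m. of_bool (\<forall>x\<in>T. hval l b cs x = j))"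
    by (rule sum.swap)
  also have "\<dots> = (\<Sum>T\<in>?TT. card {cs \<in> seeds l m. \<forall>x\<in>T. hval l b cs x = j})"
    by (simp add: Int_def)
  finally have "real (card {cs \<in> seeds l m. r < card (?load cs)} * (Suc r choose m))
      \<le> (\<Sum>T\<in>?TT. real (card {cs \<in> seeds l m. \<forall>x\<in>T. hval l b cs x = j}))"
    by (simp only: flip: of_nat_sum)
  also have "\<dots> \<le> (\<Sum>T\<in>?TT. (3 / 2 * (real l / real b)) ^ m)"
  proof (rule sum_mono)
    fix T assume "T \<in> ?TT"
    then show "real (card {cs \<in> seeds l m. \<forall>x\<in>T. hval l b cs x = j}) \<le> (3 / 2 * (real l / real b)) ^ m"
      using assms by (intro card_seeds_hval_le) (auto intro: finite_subset)
  qed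
  also have "\<dots> = real (card S choose m) * (3 / 2 * (real l / real b)) ^ m"
    using assms(2) by (simp add: n_subsets)
  finally show ?thesis by simp
qed

text \<open>Up to the same factor \<open>fact m\<close>, \<open>card S choose m\<close> is at most
  \<open>card S ^ m\<close>, and \<open>Suc r choose m\<close> is at least \<open>d ^ m\<close> as
  \<open>Suc r = d + m\<close>. The condition on \<open>d\<close> then bounds each of the
  \<open>m\<close> factors by \<open>l / 2\<close>, so the overloading seeds are a fraction of at
  most \<open>1 / 2 ^ m\<close>.\<close>

lemma card_overloaded_le:
  assumes "prime l" "finite S" "S \<subseteq> {..<l}" "b > 0" "2 * b \<le> l"
    and r: "Suc r = d + m" and d: "3 * real (card S) \<le> real d * real b" and "d > 0"
  shows "real (card {cs \<in> seeds l m. r < card {i\<in>S. hval l b cs i = j}}) \<le> (real l / 2) ^ m"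
proof -
  let ?N = "real (card {cs \<in> seeds l m. r < card {i\<in>S. hval l b cs i = j}})"
  let ?q = "3 / 2 * (real l / real b)"
  have "?N * real d ^ m \<le> ?N * (fact m * real (Suc r choose m))"
  proof (rule mult_left_mono)
    have "real (d ^ m) \<le> real (fact m * ((d + m) choose m))"
      by (rule of_nat_mono[OF power_le_fact_times_binomial])
    then show "real d ^ m \<le> fact m * real (Suc r choose m)" by (simp add: r)
  qed simp
  also have "\<dots> = fact m * (?N * real (Suc r choose m))"
    by (rule mult.left_commute)
  also have "\<dots> \<le> fact m * (real (card S choose m) * ?q ^ m)"
    by (rule mult_left_mono[OF card_overloaded_times_binomial_le[OF assms(1-5)]]) simp
  also have "\<dots> \<le> real (card S) ^ m * ?q ^ m"
  proof -
    have "real ((card S choose m) * fact m) \<le> real (card S ^ m)"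
      by (rule of_nat_mono[OF binomial_fact_pow])
    then have "fact m * real (card S choose m) \<le> real (card S) ^ m"
      by (simp add: mult.commute)
    then have "fact m * real (card S choose m) * ?q ^ m \<le> real (card S) ^ m * ?q ^ m"
      by (intro mult_right_mono) auto
    then show ?thesis by (simp only: mult.assoc)
  qed
  also have "\<dots> = (real (card S) * ?q) ^ m"
    by (simp only: power_mult_distrib)
  also have "\<dots> \<le> (real d * (real l / 2)) ^ m"
  proof (rule power_mono)
    have "3 * real (card S) / real b \<le> real d"
      using d assms(4) by (simp add: field_simps)
    then have "(3 * real (card S) / real b) * (real l / 2) \<le> real d * (real l / 2)"
      by (rule mult_right_mono) simp
    then show "real (card S) * ?q \<le> real d * (real l / 2)" by (simp add: field_simps)
  qed simp
  also have "\<dots> = (real l / 2) ^ m * real d ^ m"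
    by (simp only: power_mult_distrib[of "real d"]) (rule mult.commute)
  finally show ?thesis using \<open>d > 0\<close> by simp
qed

lemma le_two_power_clog: "1 \<le> k \<Longrightarrow> k \<le> 2 ^ clog k"
proof -
  assume "1 \<le> k"
  then have "real k = 2 powr log 2 (real k)" by simp
  also have "\<dots> \<le> 2 powr real (clog k)" by (intro powr_mono log_le_clog) simp
  also have "\<dots> = real (2 ^ clog k)" by (simp add: powr_realpow)
  finally show ?thesis by (simp only: of_nat_le_iff)
qed

lemma par_B_le: "2 \<le> k \<Longrightarrow> par_B k \<le> k"
proof -
  assume k: "2 \<le> k"
  have "real k / log 2 (real k) \<le> real k / 1"
    using log2_ge_1[OF k] k by (intro divide_left_mono) auto
  then have "\<lceil>real k / log 2 (real k)\<rceil> \<le> int k" by (simp add: ceiling_le_iff)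
  then show ?thesis by (simp add: par_B_def nat_le_iff)
qed

text \<open>Each bucket is overloaded for a fraction of at most \<open>1 / 2 ^ par_t k\<close> of
  the seeds. The union over the buckets costs at most the factor \<open>2 ^ clog k\<close>, and
  \<open>par_t k \<ge> clog k + 4\<close> leaves 1/16.\<close>

lemma card_some_bucket_overloaded_le:
  assumes "prime l" "finite S" "S \<subseteq> {..<l}" "2 \<le> k" "2 * par_B k \<le> l" "card S \<le> k"
  shows "real (card {cs \<in> seeds l (par_t k). \<exists>j\<in>{1..par_B k}.
      par_s k < card {i\<in>S. hval l (par_B k) cs i = j}}) \<le> real l ^ par_t k / 16"
proof -
  let ?bad = "\<lambda>j. {cs \<in> seeds l (par_t k). par_s k < card {i\<in>S. hval l (par_B k) cs i = j}}"
  have "real (card (?bad j)) \<le> (real l / 2) ^ par_t k" for j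
  \<comment> \<open>\<open>d\<close> is \<open>par_s k + 1 - par_t k\<close>; it is at least three
    times \<open>clog k\<close>, which bounds the mean load \<open>k / par_B k\<close>.\<close>
  proof (rule card_overloaded_le[where d = "3 * clog k + 13"])
    have "3 * real (card S) \<le> 3 * (log 2 (real k) * real (par_B k))"
      using assms(6) real_k_le_par_B[OF assms(4)] by simp
    also have "\<dots> \<le> 3 * (real (clog k) * real (par_B k))"
      by (intro mult_left_mono mult_right_mono log_le_clog) auto
    also have "\<dots> \<le> real (3 * clog k + 13) * real (par_B k)"
      by (simp add: algebra_simps)
    finally show "3 * real (card S) \<le> real (3 * clog k + 13) * real (par_B k)" .
  qed (use assms par_B_pos[of k] in \<open>auto simp: par_s_def par_t_def\<close>)
  moreover have "{cs \<in> seeds l (par_t k). \<exists>j\<in>{1..par_B k}.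
      par_s k < card {i\<in>S. hval l (par_B k) cs i = j}} = (\<Union>j\<in>{1..par_B k}. ?bad j)"
    by auto
  moreover have "card (\<Union>j\<in>{1..par_B k}. ?bad j) \<le> (\<Sum>j\<in>{1..par_B k}. card (?bad j))"
    by (rule card_UN_le) simp
  ultimately have "real (card {cs \<in> seeds l (par_t k). \<exists>j\<in>{1..par_B k}.
      par_s k < card {i\<in>S. hval l (par_B k) cs i = j}}) \<le> (\<Sum>j\<in>{1..par_B k}. (real l / 2) ^ par_t k)"
    by (smt (verit, best) of_nat_mono of_nat_sum sum_mono)
  also have "\<dots> = real (par_B k) * (real l ^ par_t k / 2 ^ par_t k)"
    by (simp add: power_divide)
  also have "\<dots> \<le> real l ^ par_t k / 16"
  proof -
    have "par_B k * 16 \<le> 2 ^ clog k * 2 ^ 4"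
      using par_B_le[OF assms(4)] le_two_power_clog[of k] assms(4) by simp
    also have "\<dots> \<le> (2::nat) ^ par_t k"
      unfolding power_add[symmetric] by (intro power_increasing) (auto simp: par_t_def)
    finally have "real (par_B k) * 16 \<le> 2 ^ par_t k"
      by (metis of_nat_le_iff of_nat_mult of_nat_numeral of_nat_power)
    then have "real (par_B k) * 16 * real l ^ par_t k \<le> 2 ^ par_t k * real l ^ par_t k"
      by (intro mult_right_mono) auto
    then show ?thesis by (simp add: field_simps)
  qed
  finally show ?thesis .
qed

text \<open>\<open>h\<close> is an arbitrary assignment to buckets, fixed while the seed of the
  second hash function varies. Collisions count only within a bucket, which leaves at most
  \<open>N * r\<^sup>2 / 2\<close> pairs instead of all pairs in \<open>S\<close>.\<close>

lemma card_some_bucket_collides_le: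
  assumes "prime l" "finite S" "S \<subseteq> {..<l}" "b > 0" "2 * b \<le> l" "4 * r\<^sup>2 * N \<le> b"
    and load: "\<And>j. j \<in> {1..N} \<Longrightarrow> card {i\<in>S. h i = j} \<le> r"
  shows "real (card {cs \<in> seeds l 2. \<exists>j\<in>{1..N}. \<not> inj_on (hval l b cs) {i\<in>S. h i = j}})
    \<le> 3 / 16 * (real l)\<^sup>2"
proof -
  let ?TT = "\<lambda>j. {T. T \<subseteq> {i\<in>S. h i = j} \<and> card T = 2}"
  let ?col = "\<lambda>T. {cs \<in> seeds l 2. \<exists>y. \<forall>x\<in>T. hval l b cs x = y}"
  have fTT: "finite (?TT j)" for j using assms(2) by simp
  have "{cs \<in> seeds l 2. \<exists>j\<in>{1..N}. \<not> inj_on (hval l b cs) {i\<in>S. h i = j}}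
      \<subseteq> (\<Union>j\<in>{1..N}. \<Union>T\<in>?TT j. ?col T)"
  proof
    fix cs assume "cs \<in> {cs \<in> seeds l 2. \<exists>j\<in>{1..N}. \<not> inj_on (hval l b cs) {i\<in>S. h i = j}}"
    then obtain j x y where j: "cs \<in> seeds l 2" "j \<in> {1..N}" "x \<in> S" "h x = j" "y \<in> S" "h y = j"
      "x \<noteq> y" "hval l b cs x = hval l b cs y"
      by (auto simp: inj_on_def)
    then have "{x, y} \<in> ?TT j" "cs \<in> ?col {x, y}" by auto
    then show "cs \<in> (\<Union>j\<in>{1..N}. \<Union>T\<in>?TT j. ?col T)" using j(2) by blast
  qed
  then have "card {cs \<in> seeds l 2. \<exists>j\<in>{1..N}. \<not> inj_on (hval l b cs) {i\<in>S. h i = j}}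
      \<le> card (\<Union>j\<in>{1..N}. \<Union>T\<in>?TT j. ?col T)"
    using fTT by (intro card_mono) auto
  also have "\<dots> \<le> (\<Sum>j\<in>{1..N}. card (\<Union>T\<in>?TT j. ?col T))"
    by (rule card_UN_le) simp
  also have "\<dots> \<le> (\<Sum>j\<in>{1..N}. \<Sum>T\<in>?TT j. card (?col T))"
    by (intro sum_mono card_UN_le fTT)
  finally have "real (card {cs \<in> seeds l 2. \<exists>j\<in>{1..N}. \<not> inj_on (hval l b cs) {i\<in>S. h i = j}})
      \<le> (\<Sum>j\<in>{1..N}. \<Sum>T\<in>?TT j. real (card (?col T)))"
    by (simp only: flip: of_nat_sum)
  also have "\<dots> \<le> (\<Sum>j\<in>{1..N}. \<Sum>T\<in>?TT j. 3 / 2 * (real l)\<^sup>2 / real b)"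
    using assms by (intro sum_mono card_seeds_collision_le) auto
  also have "\<dots> = (\<Sum>j\<in>{1..N}. real (card {i\<in>S. h i = j} choose 2) * (3 / 2 * (real l)\<^sup>2 / real b))"
    using assms(2) by (simp add: n_subsets)
  also have "\<dots> \<le> (\<Sum>j\<in>{1..N}. (real r)\<^sup>2 / 2 * (3 / 2 * (real l)\<^sup>2 / real b))"
  proof (intro sum_mono mult_right_mono)
    fix j assume "j \<in> {1..N}"
    then have "(card {i\<in>S. h i = j} choose 2) \<le> (r choose 2)"
      by (intro binomial_right_mono load)
    also have "\<dots> = r * (r - 1) div 2" by (rule choose_two)
    finally have "2 * (card {i\<in>S. h i = j} choose 2) \<le> r * (r - 1)" by linarith
    also have "\<dots> \<le> r\<^sup>2" by (simp add: power2_eq_square)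
    finally have "real (2 * (card {i\<in>S. h i = j} choose 2)) \<le> real (r\<^sup>2)" by (rule of_nat_mono)
    then show "real (card {i\<in>S. h i = j} choose 2) \<le> (real r)\<^sup>2 / 2" by simp
  qed simp
  also have "\<dots> = 3 / 16 * (real l)\<^sup>2 * (real (4 * r\<^sup>2 * N) / real b)"
    by simp
  also have "\<dots> \<le> 3 / 16 * (real l)\<^sup>2 * 1"
    using assms(4,6) by (intro mult_left_mono) (simp_all del: of_nat_mult of_nat_power)
  finally show ?thesis by simp
qed

section \<open>Combining the two independent random seeds\<close>

lemma pair_pmf_of_set:
  assumes "finite A" "A \<noteq> {}" "finite B" "B \<noteq> {}"
  shows "pair_pmf (pmf_of_set A) (pmf_of_set B) = pmf_of_set (A \<times> B)"
proof (rule pmf_eqI)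
  fix x :: "'a \<times> 'b"
  show "pmf (pair_pmf (pmf_of_set A) (pmf_of_set B)) x = pmf (pmf_of_set (A \<times> B)) x"
    using assms by (cases x) (simp add: pmf_pair card_cartesian_product indicator_def)
qed

text \<open>The good second choices may depend on the first choice, just as the pairs that must not
  collide depend on \<open>h1\<close>. Counting \<open>Sigma A' B'\<close> fibre by fibre gives the
  product of the two fractions.\<close>

lemma prob_pair_pmf_of_set_ge:
  assumes A: "finite A" "A \<noteq> {}" and B: "finite B" "B \<noteq> {}"
    and A': "A' \<subseteq> A" "\<alpha> * real (card A) \<le> real (card A')"
    and B': "\<And>a. a \<in> A' \<Longrightarrow> B' a \<subseteq> B \<and> \<beta> * real (card B) \<le> real (card (B' a))"
    and E: "\<And>a b. a \<in> A' \<Longrightarrow> b \<in> B' a \<Longrightarrow> (a, b) \<in> E" and "0 \<le> \<beta>"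
  shows "\<alpha> * \<beta> \<le> measure_pmf.prob (pair_pmf (pmf_of_set A) (pmf_of_set B)) E"
proof -
  have fin: "finite A'" "\<forall>a\<in>A'. finite (B' a)"
    using finite_subset[OF A'(1) A(1)] B' finite_subset[OF _ B(1)] by blast+
  have "\<alpha> * real (card A) * (\<beta> * real (card B)) \<le> real (card A') * (\<beta> * real (card B))"
    using A'(2) \<open>0 \<le> \<beta>\<close> by (intro mult_right_mono) auto
  also have "\<dots> = (\<Sum>a\<in>A'. \<beta> * real (card B))"
    by simp
  also have "\<dots> \<le> (\<Sum>a\<in>A'. real (card (B' a)))"
    using B' by (intro sum_mono) auto
  also have "\<dots> = real (card (Sigma A' B'))"
    using fin by simp
  also have "\<dots> \<le> real (card ((A \<times> B) \<inter> E))"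
  proof (intro of_nat_mono card_mono)
    show "Sigma A' B' \<subseteq> (A \<times> B) \<inter> E" using A'(1) B' E by fast
  qed (use A B in auto)
  finally have "\<alpha> * \<beta> * real (card (A \<times> B)) \<le> real (card ((A \<times> B) \<inter> E))"
    by (simp add: card_cartesian_product mult.assoc mult.left_commute)
  moreover have "0 < real (card (A \<times> B))"
    using A B by (simp add: card_cartesian_product card_gt_0_iff)
  ultimately have "\<alpha> * \<beta> \<le> real (card ((A \<times> B) \<inter> E)) / real (card (A \<times> B))"
    by (simp only: pos_le_divide_eq)
  then show ?thesis
    using A B by (simp add: pair_pmf_of_set measure_pmf_of_set)
qed

lemma report_correct_probability:
  assumes dec: "sparse_recovery D dec" and params: "valid_params k n M p g l1 l2"
    and us: "valid_stream n M us" and L1: "L1 n us \<le> int k"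
  shows "measure_pmf.prob (pair_pmf (pmf_of_set (seeds l1 (par_t k))) (pmf_of_set (seeds l2 2)))
          {(cs1, cs2). report dec (process w us (init k p g l1 l2 cs1 cs2)) = L1 n us} \<ge> 3 / 4"
proof -
  define S where "S = {i\<in>{1..n}. freq us i \<noteq> 0}"
  define A where "A = seeds l1 (par_t k)"
  define B where "B = seeds l2 2"
  define bad1 where "bad1 = {cs \<in> A. \<exists>j\<in>{1..par_B k}. par_s k < card {i\<in>S. hval l1 (par_B k) cs i = j}}"
  define bad2 where "bad2 cs1 = {cs \<in> B. \<exists>j\<in>{1..par_B k}.
      \<not> inj_on (hval l2 (p - 1) cs) {i\<in>S. hval l1 (par_B k) cs1 i = j}}" for cs1
  have pr: "2 \<le> k" "prime l1" "prime l2" "prime p" "2 * n \<le> l1" "2 * par_B k \<le> l1"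
      "2 * n \<le> l2" "2 * (p - 1) \<le> l2" "4 * (par_s k)\<^sup>2 * par_B k \<le> p - 1" "1 \<le> n"
    using params by (auto simp: valid_params_def par_C_eq)
  have valid: "\<forall>(i, v)\<in>set us. i \<in> {1..n} \<and> \<bar>v\<bar> \<le> int M"
    using us by (simp add: valid_stream_def)
  have S: "finite S" "S \<subseteq> {..<l1}" "S \<subseteq> {..<l2}"
    using pr by (auto simp: S_def)
  have "int (card S) = (\<Sum>i\<in>S. 1)" by simp
  also have "\<dots> \<le> (\<Sum>i\<in>S. \<bar>freq us i\<bar>)" by (intro sum_mono) (auto simp: S_def)
  also have "\<dots> \<le> L1 n us" unfolding L1_def by (intro sum_mono2) (auto simp: S_def)
  finally have cardS: "card S \<le> k" using L1 by linarith
  have cardA: "real (card A) = real l1 ^ par_t k" and cardB: "real (card B) = (real l2)\<^sup>2"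
    by (simp_all add: A_def B_def card_seeds)
  have fin: "finite A" "finite B" by (simp_all add: A_def B_def)
  have "0 < card A" "0 < card B" using pr prime_gt_0_nat by (simp_all add: A_def B_def card_seeds)
  then have ne: "A \<noteq> {}" "B \<noteq> {}" by auto
  have bad1: "real (card bad1) \<le> real (card A) / 16"
    unfolding bad1_def cardA unfolding A_def
    by (rule card_some_bucket_overloaded_le) (use pr S cardS in auto)
  have bad2: "real (card (bad2 cs1)) \<le> 3 / 16 * real (card B)" if "cs1 \<in> A - bad1" for cs1
    unfolding bad2_def cardB unfolding B_def
  proof (rule card_some_bucket_collides_le[where r = "par_s k"])
    show "card {i\<in>S. hval l1 (par_B k) cs1 i = j} \<le> par_s k" if "j \<in> {1..par_B k}" for j
      using that \<open>cs1 \<in> A - bad1\<close> by (auto simp: bad1_def not_less)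
  qed (use pr S prime_gt_1_nat[of p] in auto)
  \<comment> \<open>The product is 195/256, just above 3/4 = 192/256.\<close>
  have "15 / 16 * (13 / 16) \<le> measure_pmf.prob (pair_pmf (pmf_of_set A) (pmf_of_set B))
      {(cs1, cs2). report dec (process w us (init k p g l1 l2 cs1 cs2)) = L1 n us}"
  proof (rule prob_pair_pmf_of_set_ge[where \<alpha> = "15 / 16" and \<beta> = "13 / 16" and A' = "A - bad1" and B' = "\<lambda>cs1. B - bad2 cs1"])
    have "card (A - bad1) = card A - card bad1"
      using fin by (intro card_Diff_subset) (auto simp: bad1_def)
    then show "15 / 16 * real (card A) \<le> real (card (A - bad1))" using bad1 by linarith
    show "B - bad2 cs1 \<subseteq> B \<and> 13 / 16 * real (card B) \<le> real (card (B - bad2 cs1))"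
      if "cs1 \<in> A - bad1" for cs1
    proof -
      have "card (B - bad2 cs1) = card B - card (bad2 cs1)"
        using fin by (intro card_Diff_subset) (auto simp: bad2_def)
      then show ?thesis using bad2[OF that] by auto
    qed
    fix cs1 cs2 assume cs: "cs1 \<in> A - bad1" "cs2 \<in> B - bad2 cs1"
    interpret estimator k n M p g l1 l2 cs1 cs2
      using params cs by unfold_locales (auto simp: A_def B_def)
    have eq: "{i\<in>{1..n}. h1 i = j \<and> freq us i \<noteq> 0} = {i\<in>S. hval l1 (par_B k) cs1 i = j}" for j
      by (auto simp: S_def h1_def)
    have "report dec (state us) = L1 n us"
    proof (rule report_correct[OF dec _ L1])
      show "\<forall>(i, v)\<in>set us. i \<in> {1..n}" using valid by auto
      show "card {i\<in>{1..n}. h1 i = j \<and> freq us i \<noteq> 0} \<le> s" if "j \<in> {1..nB}" for j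
        using that cs unfolding eq by (auto simp: bad1_def not_less)
      show "inj_on h2 {i\<in>{1..n}. h1 i = j \<and> freq us i \<noteq> 0}" if "j \<in> {1..nB}" for j
        using that cs unfolding eq h2_def by (auto simp: bad2_def)
    qed
    then show "(cs1, cs2) \<in> {(cs1, cs2). report dec (process w us (init k p g l1 l2 cs1 cs2)) = L1 n us}"
      by (simp add: process_state[OF valid])
  qed (use fin ne in auto)
  then show ?thesis unfolding A_def B_def by simp
qed

section \<open>Elementary estimates of logarithms and parameters\<close>

section \<open>Asymptotic bounds\<close>

lemma real_floorlog_le: "1 \<le> x \<Longrightarrow> real (floorlog 2 x) \<le> log 2 (real x) + 1"
proof -
  assume "1 \<le> x"
  then have "0 \<le> log 2 (real x)" by simp
  then show ?thesis
    using \<open>1 \<le> x\<close> unfolding floorlog_def by (simp add: of_nat_nat)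
qed

lemma log2_le_self: "1 \<le> x \<Longrightarrow> log 2 x \<le> x" for x :: real
proof -
  assume x: "1 \<le> x"
  have "ln x \<le> x * ln 2"
  proof -
    \<comment> \<open>Taken at \<open>x / 2\<close>, the bound \<open>ln y \<le> y - 1\<close> has
      slope 1/2 in \<open>x\<close>, which is below \<open>ln 2\<close>; taken at \<open>x\<close>
      its slope 1 would be too large.\<close>
    have "ln (x / 2) \<le> x / 2 - 1" using x by (intro ln_le_minus_one) simp
    then have "ln x \<le> x / 2 - 1 + ln 2" using x by (simp add: ln_div)
    moreover have "1 / 2 \<le> ln (2::real)" "ln (2::real) \<le> 1"
      using ln_le_minus_one[of "1 / 2 :: real"] ln_le_minus_one[of "2 :: real"] by (simp_all add: ln_div)
    moreover have "x * (1 / 2) \<le> x * ln 2" using x \<open>1 / 2 \<le> ln (2::real)\<close> by (intro mult_left_mono) auto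
    ultimately show ?thesis by linarith
  qed
  then show ?thesis by (simp add: log_def field_simps)
qed

text \<open>The logarithm of the fourth root of \<open>x\<close> is at most that root. This absorbs
  the polylogarithmic work space of the decoder into the bound for the sketch.\<close>

lemma log2_power4_le: "1 \<le> x \<Longrightarrow> (log 2 x) ^ 4 \<le> 256 * x" for x :: real
proof -
  assume x: "1 \<le> x"
  define y where "y = x powr (1 / 4)"
  have "log 2 x = 4 * log 2 y"
    using x by (simp add: y_def log_powr)
  also have "\<dots> \<le> 4 * y"
    using x by (intro mult_left_mono log2_le_self) (auto simp: y_def ge_one_powr_ge_zero)
  finally have "(log 2 x) ^ 4 \<le> (4 * y) ^ 4"
    using x by (intro power_mono) auto
  also have "y ^ 4 = x"
    using x by (simp add: y_def powr_powr flip: powr_realpow)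
  then have "(4 * y) ^ 4 = 256 * x" by (simp add: power_mult_distrib)
  finally show ?thesis .
qed

lemma clog_le: "2 \<le> k \<Longrightarrow> real (clog k) \<le> 2 * log 2 (real k)"
proof -
  assume k: "2 \<le> k"
  have "real (clog k) \<le> log 2 (real k) + 1"
    using log2_ge_1[OF k] unfolding clog_def by linarith
  then show ?thesis using log2_ge_1[OF k] by linarith
qed

lemma par_s_le: "2 \<le> k \<Longrightarrow> real (par_s k) \<le> 34 * log 2 (real k)"
  unfolding par_s_eq using clog_le[of k] log2_ge_1[of k] by linarith

lemma par_t_le: "2 \<le> k \<Longrightarrow> real (par_t k) \<le> 16 * log 2 (real k)"
  unfolding par_t_def using clog_le[of k] log2_ge_1[of k] by linarith

lemma log_times_par_B_le: "2 \<le> k \<Longrightarrow> log 2 (real k) * real (par_B k) \<le> 2 * real k"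
proof -
  assume k: "2 \<le> k"
  let ?L = "log 2 (real k)"
  have L: "1 \<le> ?L" "?L \<le> real k" using log2_ge_1[OF k] log2_le_self[of "real k"] k by auto
  have "0 \<le> real k / ?L" using L by simp
  then have "real (par_B k) \<le> real k / ?L + 1"
    unfolding par_B_def by linarith
  then have "?L * real (par_B k) \<le> ?L * (real k / ?L + 1)"
    using L by (intro mult_left_mono) auto
  also have "\<dots> = real k + ?L" using L by (simp add: field_simps)
  finally show ?thesis using L by linarith
qed

lemma words_le:
  assumes "1 \<le> Y" "0 < w" "log 2 (real Y) + 1 \<le> G * real w"
  shows "real (words w (int Y)) \<le> G + 1"
proof -
  have "real (floorlog 2 Y div w) \<le> real (floorlog 2 Y) / real w"
    by (rule of_nat_div_le_of_nat)
  also have "\<dots> \<le> G * real w / real w"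
    using real_floorlog_le[OF assms(1)] assms(3) by (intro divide_right_mono) auto
  also have "\<dots> = G" using assms(2) by simp
  finally show ?thesis by (simp add: words_def)
qed

section \<open>Space and time of a run with fixed seeds\<close>

context estimator begin

abbreviation "L \<equiv> log 2 (real k)"

lemma L: "1 \<le> L" "L \<le> real k" "1 \<le> real k"
  using log2_ge_1[OF basic(1)] log2_le_self[of "real k"] basic(1) by auto

text \<open>\<open>p\<close> has the order of \<open>s\<^sup>2 * nB\<close>, where \<open>s\<close>
  is of order \<open>L\<close> and \<open>L * nB\<close> of order \<open>k\<close>. The factor 9248
  is \<open>2 * 4 * 34\<^sup>2\<close>, doubled by the bound on \<open>L * nB\<close>; the slack up
  to 20000 absorbs the summand 2.\<close>

lemma p_le: "real p \<le> 20000 * (real k * L)"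
proof -
  have kL: "1 \<le> real k * L" using mult_mono[of 1 "real k" 1 L] L by simp
  have "real p \<le> 2 * (4 * (real s)\<^sup>2 * real nB + 1)"
  proof -
    have "p \<le> 2 * (4 * s\<^sup>2 * nB + 1)" using params by (auto simp: valid_params_def par_C_eq)
    then have "real p \<le> real (2 * (4 * s\<^sup>2 * nB + 1))" by (rule of_nat_mono)
    then show ?thesis by simp
  qed
  also have "\<dots> \<le> 2 * (4 * (34 * L)\<^sup>2 * real nB + 1)"
    using par_s_le[OF basic(1)] by (intro mult_left_mono add_mono mult_right_mono power_mono) auto
  also have "\<dots> = 9248 * L * (L * real nB) + 2"
    by (simp add: power2_eq_square)
  also have "\<dots> \<le> 9248 * L * (2 * real k) + 2"
    using log_times_par_B_le[OF basic(1)] L by (intro add_mono mult_left_mono) auto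
  also have "\<dots> \<le> 20000 * (real k * L)"
    using kL by (simp add: algebra_simps)
  finally show ?thesis .
qed

lemma log_p_le: "log 2 (real p) \<le> 17 * L"
proof -
  have "real p \<le> 20000 * (real k * L)" by (rule p_le)
  \<comment> \<open>20000 is below \<open>2 ^ 15\<close>, and weakening \<open>L\<close> to
    \<open>k\<close> makes the logarithm \<open>15 + 2 * L\<close>.\<close>
  also have "\<dots> \<le> 2 ^ 15 * (real k * real k)"
    using L by (intro mult_mono) auto
  finally have "log 2 (real p) \<le> log 2 (2 ^ 15 * (real k * real k))"
    using pos L by (subst log_le_cancel_iff) auto
  also have "\<dots> = 15 + 2 * L"
    using L log_pow_cancel[of "2 :: real" 15] by (simp add: log_mult)
  finally show ?thesis using L by linarith
qed

lemma log_p_nonneg: "0 \<le> log 2 (real p)"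
  using pos by simp

lemma floorlog_p_le: "real (floorlog 2 p) \<le> 18 * L"
  using real_floorlog_le[of p] log_p_le L pos by linarith

lemma counters_le: "real (nB * (2 * s)) \<le> 136 * real k"
proof -
  have "real (nB * (2 * s)) \<le> 2 * real nB * (34 * L)"
    using mult_left_mono[OF par_s_le[OF basic(1)], of "2 * real nB"] by simp
  also have "\<dots> = 68 * (L * real nB)" by simp
  finally show ?thesis using log_times_par_B_le[OF basic(1)] by linarith
qed

lemma sketch_bits_state_le: "real (sketch_bits (state us)) \<le> 2520 * (real k * L)"
proof -
  have "real (sketch_bits (state us)) = real (floorlog 2 p) * (4 + real (nB * (2 * s)))"
    by (simp add: sketch_bits_def bits_def width_def cells_def state_Params state_Counters algebra_simps)
  also have "\<dots> \<le> 18 * L * (140 * real k)"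
    using floorlog_p_le counters_le L by (intro mult_mono) auto
  finally show ?thesis by (simp add: mult_ac)
qed

text \<open>The inner logarithms of \<open>s\<close> are bounded by \<open>s\<close> itself. This is
  crude, but the order \<open>L ^ 4\<close> is still covered by \<open>log2_power4_le\<close>. With
  \<open>\<bar>D\<bar>\<close> the estimates are monotone without a case distinction on the sign of
  \<open>D\<close>.\<close>

lemma decoding_ops_le:
  assumes "sparse_recovery D dec" "dec p s (bucket us j) = (out, ops)"
  shows "real ops \<le> 708628 * \<bar>D\<bar> * L ^ 4"
proof -
  let ?s = "real s"
  have s: "24 \<le> ?s" "?s \<le> 34 * L" using small par_s_le[OF basic(1)] by auto
  have "log 2 2 \<le> log 2 ?s" using s by (subst log_le_cancel_iff) auto
  then have ls: "1 \<le> log 2 ?s" "log 2 ?s \<le> ?s" using s log2_le_self[of ?s] by auto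
  then have lls: "0 \<le> log 2 (log 2 ?s)" "log 2 (log 2 ?s) \<le> ?s"
    using log2_le_self[of "log 2 ?s"] zero_le_log_cancel_iff[of 2 "log 2 ?s"] by linarith+
  have "real ops \<le> D * (?s\<^sup>2 + ?s * log 2 ?s * log 2 (log 2 ?s) * log 2 (real p))"
    by (rule recovered_props(4)[OF assms])
  also have "\<dots> \<le> \<bar>D\<bar> * (?s\<^sup>2 + ?s * log 2 ?s * log 2 (log 2 ?s) * log 2 (real p))"
    using s ls lls log_p_nonneg by (intro mult_right_mono add_nonneg_nonneg mult_nonneg_nonneg) auto
  also have "\<dots> \<le> \<bar>D\<bar> * ((34 * L)\<^sup>2 + 34 * L * (34 * L) * (34 * L) * (18 * L))"
    using s ls lls log_p_nonneg log_p_le L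
    by (intro mult_left_mono add_mono mult_mono power_mono mult_nonneg_nonneg) auto
  also have "\<dots> = \<bar>D\<bar> * (1156 * L ^ 2 + 707472 * L ^ 4)"
    by (simp add: power2_eq_square power4_eq_xxxx)
  also have "\<dots> \<le> \<bar>D\<bar> * (1156 * L ^ 4 + 707472 * L ^ 4)"
    using L by (intro mult_left_mono add_mono power_increasing) auto
  finally show ?thesis by (simp add: algebra_simps)
qed

text \<open>Even a wrongly decoded bucket yields at most \<open>s\<close> values of size at most
  \<open>p\<close>, and \<open>nB\<close> and \<open>s\<close> are below \<open>p\<close>. So the
  total fits into O(log \<open>p\<close>) bits for every outcome of the hashing.\<close>

lemma report_le:
  assumes "sparse_recovery D dec"
  shows "0 \<le> report dec (state us)" "report dec (state us) \<le> int (p ^ 3)"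
proof -
  have inner: "0 \<le> (\<Sum>(x, y)\<leftarrow>fst (dec p s (bucket us j)). \<bar>sigma p y\<bar>)
      \<and> (\<Sum>(x, y)\<leftarrow>fst (dec p s (bucket us j)). \<bar>sigma p y\<bar>) \<le> int (s * p)" for j
  proof -
    obtain out ops where out: "dec p s (bucket us j) = (out, ops)" by fastforce
    have "\<bar>sigma p y\<bar> \<le> int p" if "(x, y) \<in> set out" for x y
      using recovered_props(3)[OF assms out] that by (auto simp: sigma_def)
    then have "(\<Sum>(x, y)\<leftarrow>out. \<bar>sigma p y\<bar>) \<le> (\<Sum>z\<leftarrow>out. int p)"
      by (intro sum_list_mono) auto
    also have "\<dots> = int (length out * p)" by (simp add: sum_list_triv)
    also have "\<dots> \<le> int (s * p)"
      using recovered_props(1)[OF assms out] by (intro of_nat_mono mult_right_mono) auto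
    moreover have "0 \<le> (\<Sum>(x, y)\<leftarrow>out. \<bar>sigma p y\<bar>)"
      by (intro sum_list_nonneg) auto
    ultimately show ?thesis by (simp add: out)
  qed
  show "0 \<le> report dec (state us)"
    unfolding report_state using inner by (intro sum_nonneg) blast
  have "report dec (state us) \<le> (\<Sum>j = 1..nB. int (s * p))"
    unfolding report_state using inner by (intro sum_mono) blast
  also have "\<dots> = int (nB * (s * p))" by simp
  also have "\<dots> \<le> int (p * (p * p))"
    using small by (intro of_nat_mono mult_mono) auto
  finally show "report dec (state us) \<le> int (p ^ 3)" by (simp add: power3_eq_cube mult_ac)
qed

text \<open>The decoder keeps O(\<open>L ^ 4\<close>) field elements of at most
  \<open>18 * L\<close> bits, and \<open>L ^ 4\<close> is traded for \<open>256 * k\<close>, whence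
  4608. The bucket index and the total contribute 18 and 52 to the summand 70.\<close>

lemma report_bits_state_le:
  assumes "sparse_recovery D dec"
  shows "real (report_bits dec (state us)) \<le> (4608 * (136 + 708628 * \<bar>D\<bar>) + 70) * (real k * L)"
proof -
  have cP: "cells (state us) Params = [p, nB, s, t]" "width (state us) Params = floorlog 2 p"
    by (simp_all add: cells_def width_def state_Params)
  define F where "F j = (2 * s + snd (recovered dec (state us) j)
    + 2 * length (fst (recovered dec (state us) j))) * floorlog 2 p" for j
  have F: "real (F j) \<le> 4608 * (136 + 708628 * \<bar>D\<bar>) * (real k * L)" if "j \<in> {1..nB}" for j
  proof -
    obtain out ops where out: "dec p s (bucket us j) = (out, ops)" by fastforce
    have "F j = (2 * s + ops + 2 * length out) * floorlog 2 p"
      by (simp add: F_def recovered_state[OF that] out)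
    then have "real (F j) = (2 * real s + real ops + 2 * real (length out)) * real (floorlog 2 p)"
      by simp
    also have "\<dots> \<le> ((136 + 708628 * \<bar>D\<bar>) * L ^ 4) * (18 * L)"
    proof (rule mult_mono)
      have "L ^ 1 \<le> L ^ 4" using L by (intro power_increasing) auto
      then show "2 * real s + real ops + 2 * real (length out) \<le> (136 + 708628 * \<bar>D\<bar>) * L ^ 4"
        using recovered_props(1)[OF assms out] par_s_le[OF basic(1)] decoding_ops_le[OF assms out]
        by (simp add: algebra_simps)
    qed (use floorlog_p_le in auto)
    also have "\<dots> \<le> ((136 + 708628 * \<bar>D\<bar>) * (256 * real k)) * (18 * L)"
      using L log2_power4_le[of "real k"] by (intro mult_right_mono mult_left_mono) auto
    also have "\<dots> = 4608 * (136 + 708628 * \<bar>D\<bar>) * (real k * L)"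
      by (simp add: algebra_simps)
    finally show ?thesis .
  qed
  have "Max (F ` {1..nB}) \<in> F ` {1..nB}" using pos by (intro Max_in) auto
  then have Max: "real (Max (F ` {1..nB})) \<le> 4608 * (136 + 708628 * \<bar>D\<bar>) * (real k * L)"
    using F by auto
  have B: "real (floorlog 2 nB) \<le> 18 * L"
    using floorlog_mono[of nB p 2] small floorlog_p_le by linarith
  have "real (floorlog 2 (nat (report dec (state us)))) \<le> real (floorlog 2 (p ^ 3))"
    using report_le[OF assms, of us] by (intro of_nat_mono floorlog_mono) linarith
  also have "\<dots> \<le> log 2 (real (p ^ 3)) + 1"
    using pos by (intro real_floorlog_le) simp
  also have "\<dots> = 3 * log 2 (real p) + 1"
    using pos by (simp add: log_nat_power)
  also have "\<dots> \<le> 52 * L" using log_p_le L by linarith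
  finally have R: "real (floorlog 2 (nat (report dec (state us)))) \<le> 52 * L" .
  have "report_bits dec (state us)
      = Max (F ` {1..nB}) + floorlog 2 nB + floorlog 2 (nat (report dec (state us)))"
    by (simp add: report_bits_def cP F_def)
  then have "real (report_bits dec (state us))
      \<le> 4608 * (136 + 708628 * \<bar>D\<bar>) * (real k * L) + 70 * L"
    using Max B R by simp
  also have "\<dots> \<le> 4608 * (136 + 708628 * \<bar>D\<bar>) * (real k * L) + 70 * (real k * L)"
    using L mult_right_mono[of 1 "real k" L] by simp
  finally show ?thesis by (simp only: distrib_right)
qed

text \<open>A maximum of positive integers is at most their product, so the logarithm splits into a
  sum. \<open>max 1 a\<close> handles every real \<open>a\<close> and has a nonnegative
  logarithm.\<close>

lemma log_moduli_le:
  assumes "moduli_bounded a k n p l1 l2"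
  shows "log 2 (real l1) \<le> log 2 (max 1 a) + log 2 (real n) + L"
    and "log 2 (real l2) \<le> log 2 (max 1 a) + log 2 (real n) + 17 * L"
proof -
  have n: "1 \<le> real n" using basic by simp
  have bound: "log 2 (real l) \<le> log 2 (max 1 a) + log 2 (real n) + log 2 (real y)"
    if l: "real l \<le> a * real (max n x)" "0 < l" "x \<le> y" "1 \<le> y" for l x y
  proof -
    have "max n x \<le> n * y"
      using that basic mult_mono[of n n 1 y] mult_mono[of 1 n x y] by auto
    then have "real (max n x) \<le> real n * real y" by (metis of_nat_le_iff of_nat_mult)
    then have "a * real (max n x) \<le> max 1 a * (real n * real y)"
      by (intro mult_mono) auto
    with l have "real l \<le> max 1 a * (real n * real y)" by linarith
    then have "log 2 (real l) \<le> log 2 (max 1 a * (real n * real y))"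
      using l n by (subst log_le_cancel_iff) auto
    also have "\<dots> = log 2 (max 1 a) + log 2 (real n) + log 2 (real y)"
      using n l by (simp add: log_mult)
    finally show ?thesis .
  qed
  show "log 2 (real l1) \<le> log 2 (max 1 a) + log 2 (real n) + L"
    using assms pos basic par_B_le[of k] by (intro bound[of l1 nB k]) (auto simp: moduli_bounded_def)
  have "log 2 (real l2) \<le> log 2 (max 1 a) + log 2 (real n) + log 2 (real p)"
    using assms pos by (intro bound[of l2 "p - 1" p]) (auto simp: moduli_bounded_def)
  then show "log 2 (real l2) \<le> log 2 (max 1 a) + log 2 (real n) + 17 * L"
    using log_p_le by linarith
qed

text \<open>The O(\<open>L\<close>) coefficients of O(log \<open>n\<close> + \<open>L\<close>) bits
  behind \<open>h1\<close> give the term with log \<open>n\<close>; the two tables, with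
  \<open>p - 1\<close> entries of O(\<open>L\<close>) bits each, give
  \<open>k * L\<^sup>2\<close>.\<close>

lemma hash_table_bits_state_le:
  assumes "moduli_bounded a k n p l1 l2"
  shows "real (hash_table_bits (state us))
    \<le> (22 * log 2 (max 1 a) + 720130) * (L * log 2 (real n) + real k * L\<^sup>2)"
proof -
  let ?a = "log 2 (max 1 a)" and ?n = "log 2 (real n)"
  have a: "0 \<le> ?a" and n: "0 \<le> ?n" using basic by simp_all
  have f1: "real (floorlog 2 l1) \<le> ?a + ?n + 2 * L"
    using real_floorlog_le[of l1] log_moduli_le(1)[OF assms] pos L by linarith
  have f2: "real (floorlog 2 l2) \<le> ?a + ?n + 18 * L"
    using real_floorlog_le[of l2] log_moduli_le(2)[OF assms] pos L by linarith
  have t2: "real (t + 2) \<le> 18 * L" using par_t_le[OF basic(1)] L by linarith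
  have "hash_table_bits (state us)
      = floorlog 2 l1 * (t + 2) + floorlog 2 l2 * 4 + 2 * (floorlog 2 p * (p - 1))"
    by (simp add: hash_table_bits_def bits_def width_def cells_def state_Hash1 state_Hash2
        state_Table1 state_Table2 set_cs)
  then have "real (hash_table_bits (state us)) = real (floorlog 2 l1) * real (t + 2)
      + real (floorlog 2 l2) * 4 + 2 * (real (floorlog 2 p) * real (p - 1))"
    by (simp only: of_nat_add of_nat_mult of_nat_numeral)
  also have "\<dots> \<le> (?a + ?n + 2 * L) * (18 * L) + (?a + ?n + 18 * L) * 4
      + 2 * (18 * L * (20000 * (real k * L)))"
  proof (intro add_mono mult_mono mult_left_mono)
    show "real (p - 1) \<le> 20000 * (real k * L)" using p_le by linarith
  qed (use f1 f2 t2 floorlog_p_le L a n in auto)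
  also have "\<dots> = 18 * ?a * L + 18 * (L * ?n) + 36 * L\<^sup>2 + 4 * ?a + 4 * ?n + 72 * L
      + 720000 * (real k * L\<^sup>2)"
    by (simp add: algebra_simps power2_eq_square)
  also have "\<dots> \<le> 18 * ?a * (real k * L\<^sup>2) + 18 * (L * ?n) + 36 * (real k * L\<^sup>2)
      + 4 * ?a * (real k * L\<^sup>2) + 4 * (L * ?n) + 72 * (real k * L\<^sup>2) + 720000 * (real k * L\<^sup>2)"
  proof -
    have LL: "L \<le> L\<^sup>2" using L by (simp add: power2_eq_square)
    have kL: "L\<^sup>2 \<le> real k * L\<^sup>2" using mult_right_mono[OF L(3), of "L\<^sup>2"] by simp
    have "1 \<le> real k * L\<^sup>2" "L \<le> real k * L\<^sup>2" using LL kL L by linarith+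
    moreover have "?n \<le> L * ?n" using mult_right_mono[of 1 L ?n] L n by simp
    ultimately show ?thesis
      using kL a mult_left_mono[of 1 "real k * L\<^sup>2" "4 * ?a"]
        mult_left_mono[of L "real k * L\<^sup>2" "18 * ?a"] by linarith
  qed
  also have "\<dots> = 22 * (L * ?n) + (22 * ?a + 720108) * (real k * L\<^sup>2)"
    by (simp add: algebra_simps)
  also have "\<dots> \<le> (22 * ?a + 720130) * (L * ?n) + (22 * ?a + 720130) * (real k * L\<^sup>2)"
    using a n L by (intro add_mono mult_right_mono) auto
  finally show ?thesis by (simp only: distrib_left)
qed

lemma log_Y: "log 2 (real Y)
  = 1 + log 2 (real M) + 2 * log 2 (real l1) + 2 * log 2 (real l2) + 2 * log 2 (real p)"
  using basic pos by (simp add: Y_def log_mult log_nat_power)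

text \<open>\<open>Y\<close> is polynomial in \<open>n\<close>, \<open>M\<close> and
  \<open>k\<close> up to a factor depending on \<open>a\<close>, so its length is a constant number
  of words.\<close>

lemma op_cost_le:
  assumes "moduli_bounded a k n p l1 l2" "word_length_ok c k n M w" "0 < c"
  shows "real (op_cost w Y) \<le> 7 * (4 * log 2 (max 1 a) + 74 / c + 3)\<^sup>2"
proof -
  let ?a = "log 2 (max 1 a)" and ?n = "log 2 (real n)" and ?M = "log 2 (real M)"
  have a: "0 \<le> ?a" and n: "0 \<le> ?n" and M: "0 \<le> ?M" using basic by simp_all
  have w1: "c * L \<le> real w" and w2: "c * log 2 (real (n * M)) \<le> real w"
    using assms(2) by (auto simp: word_length_ok_def)
  \<comment> \<open>The bound through \<open>k\<close> makes \<open>w\<close> positive even if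
    \<open>n * M = 1\<close>, where the other bound degenerates to 0.\<close>
  have "0 < c * L" using assms(3) L by simp
  then have "0 < real w" using w1 by linarith
  then have w: "0 < w" "1 \<le> real w" by simp_all
  have nM: "log 2 (real (n * M)) = ?n + ?M" using basic by (simp add: log_mult)
  have c: "L \<le> real w / c" "?n + ?M \<le> real w / c"
    using w1 w2 assms(3) unfolding nM by (simp_all add: field_simps)
  have "log 2 (real Y) + 1 \<le> 2 + ?M + 4 * ?a + 4 * ?n + 70 * L"
    using log_Y log_moduli_le[OF assms(1)] log_p_le by linarith
  \<comment> \<open>\<open>?M + 4 * ?n\<close> is at most \<open>4 * (?n + ?M)\<close>, so 74 is 4 +
    70.\<close>
  also have "\<dots> \<le> 2 + 4 * ?a + 74 * (real w / c)"
    using c n M by linarith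
  also have "\<dots> \<le> (4 * ?a + 74 / c + 2) * real w"
    using w a mult_left_mono[of 1 "real w" "2 + 4 * ?a"] by (simp add: algebra_simps)
  finally have "real (words w (int Y)) \<le> 4 * ?a + 74 / c + 2 + 1"
    using w le_Y by (intro words_le)
  then show ?thesis
    unfolding op_cost_def by (simp add: power_mono)
qed

lemma update_time_state_le:
  assumes "moduli_bounded a k n p l1 l2" "word_length_ok c k n M w" "0 < c"
    and "i \<in> {1..n}" "\<bar>v\<bar> \<le> int M"
  shows "real (update_time w (i, v) (state us)) \<le> 6594 * (4 * log 2 (max 1 a) + 74 / c + 3)\<^sup>2 * L"
proof -
  \<comment> \<open>942 is \<open>6 * 16 + 24 * 34 + 30\<close>.\<close>
  have ops: "6 * real t + 24 * real s + 30 \<le> 942 * L"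
    using par_s_le[OF basic(1)] par_t_le[OF basic(1)] L by linarith
  have "real (update_time w (i, v) (state us)) \<le> real ((6 * t + 24 * s + 30) * op_cost w Y)"
    by (rule of_nat_mono[OF update_state(2)[OF assms(4,5)]])
  also have "\<dots> = (6 * real t + 24 * real s + 30) * real (op_cost w Y)" by simp
  also have "\<dots> \<le> (942 * L) * (7 * (4 * log 2 (max 1 a) + 74 / c + 3)\<^sup>2)"
    using ops L op_cost_le[OF assms(1-3)] by (intro mult_mono) auto
  finally show ?thesis by (simp add: mult_ac)
qed

end

text \<open>\<open>K\<close> is chosen before all sizes, so it can depend on \<open>D\<close>,
  \<open>a\<close> and \<open>c\<close> only. The claims on space and time range over all seeds and
  thus hold for every outcome of the hash functions; only exactness is probabilistic.\<close>

theorem theorem3: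
  fixes dec :: decoder and D a c :: real
  assumes "sparse_recovery D dec" and "c > 0"
  shows
    "(\<exists>K. \<forall>k n M p g l1 l2 w us. \<forall>cs1\<in>seeds l1 (par_t k). \<forall>cs2\<in>seeds l2 2.
        valid_params k n M p g l1 l2 \<and> valid_stream n M us \<longrightarrow>
        (\<forall>i\<le>length us.
           real (sketch_bits (process w (take i us) (init k p g l1 l2 cs1 cs2)))
             \<le> K * (real k * log 2 (real k))) \<and>
        real (sketch_bits (process w us (init k p g l1 l2 cs1 cs2))
              + report_bits dec (process w us (init k p g l1 l2 cs1 cs2)))
          \<le> K * (real k * log 2 (real k)))
     \<and>
     (\<exists>K. \<forall>k n M p g l1 l2 w us. \<forall>cs1\<in>seeds l1 (par_t k). \<forall>cs2\<in>seeds l2 2.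
        valid_params k n M p g l1 l2 \<and> moduli_bounded a k n p l1 l2 \<and> valid_stream n M us \<longrightarrow>
        (\<forall>i\<le>length us.
           real (hash_table_bits (process w (take i us) (init k p g l1 l2 cs1 cs2)))
             \<le> K * (log 2 (real k) * log 2 (real n) + real k * (log 2 (real k))\<^sup>2)))
     \<and>
     (\<exists>K. \<forall>k n M p g l1 l2 w us. \<forall>cs1\<in>seeds l1 (par_t k). \<forall>cs2\<in>seeds l2 2.
        valid_params k n M p g l1 l2 \<and> moduli_bounded a k n p l1 l2 \<and>
        word_length_ok c k n M w \<and> valid_stream n M us \<longrightarrow>
        (\<forall>i<length us.
           real (update_time w (us ! i) (process w (take i us) (init k p g l1 l2 cs1 cs2)))
             \<le> K * log 2 (real k)))
     \<and>
     (\<forall>k n M p g l1 l2 w us.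
        valid_params k n M p g l1 l2 \<and> valid_stream n M us \<and> L1 n us \<le> int k \<longrightarrow>
        measure_pmf.prob (pair_pmf (pmf_of_set (seeds l1 (par_t k))) (pmf_of_set (seeds l2 2)))
          {(cs1, cs2). report dec (process w us (init k p g l1 l2 cs1 cs2)) = L1 n us}
        \<ge> 3 / 4)"
    (is "?space \<and> ?hash_space \<and> ?time \<and> ?correct")
proof (intro conjI)
  \<comment> \<open>A prefix of a valid stream is in general not valid, but its indices and values
    stay in range, which is all that \<open>process_state\<close> asks for.\<close>
  have prefix: "\<forall>(j, v)\<in>set (take i us). j \<in> {1..n} \<and> \<bar>v\<bar> \<le> int M"
    if "valid_stream n M us" for n M us i
    using that set_take_subset[of i us] by (auto simp: valid_stream_def)
  show ?space
  proof (intro exI allI ballI impI)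
    fix k n M p g l1 l2 w :: nat and us cs1 cs2
    assume cs: "cs1 \<in> seeds l1 (par_t k)" "cs2 \<in> seeds l2 2"
      and valid: "valid_params k n M p g l1 l2 \<and> valid_stream n M us"
    interpret estimator k n M p g l1 l2 cs1 cs2
      using cs valid by unfold_locales auto
    let ?K = "2520 + (4608 * (136 + 708628 * \<bar>D\<bar>) + 70)"
    have st: "process w (take i us) (init k p g l1 l2 cs1 cs2) = state (take i us)" for i
      using valid by (intro process_state prefix) auto
    have "real (sketch_bits (state us) + report_bits dec (state us)) \<le> ?K * (real k * log 2 (real k))"
      using sketch_bits_state_le[of us] report_bits_state_le[OF assms(1), of us]
      by (simp only: of_nat_add distrib_right)
    moreover have "real (sketch_bits (state (take i us))) \<le> ?K * (real k * log 2 (real k))" for i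
      using sketch_bits_state_le[of "take i us"] L
      by (elim order.trans) (intro mult_right_mono, auto)
    ultimately show "(\<forall>i\<le>length us.
           real (sketch_bits (process w (take i us) (init k p g l1 l2 cs1 cs2)))
             \<le> ?K * (real k * log 2 (real k))) \<and>
        real (sketch_bits (process w us (init k p g l1 l2 cs1 cs2))
              + report_bits dec (process w us (init k p g l1 l2 cs1 cs2)))
          \<le> ?K * (real k * log 2 (real k))"
      using st st[of "length us"] by (simp only: take_all order.refl) blast
  qed
  show ?hash_space
  proof (intro exI allI ballI impI)
    fix k n M p g l1 l2 w i :: nat and us cs1 cs2
    assume cs: "cs1 \<in> seeds l1 (par_t k)" "cs2 \<in> seeds l2 2"
      and valid: "valid_params k n M p g l1 l2 \<and> moduli_bounded a k n p l1 l2 \<and> valid_stream n M us"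
    interpret estimator k n M p g l1 l2 cs1 cs2
      using cs valid by unfold_locales auto
    have "process w (take i us) (init k p g l1 l2 cs1 cs2) = state (take i us)"
      using valid by (intro process_state prefix) auto
    then show "real (hash_table_bits (process w (take i us) (init k p g l1 l2 cs1 cs2)))
        \<le> (22 * log 2 (max 1 a) + 720130)
          * (log 2 (real k) * log 2 (real n) + real k * (log 2 (real k))\<^sup>2)"
      using hash_table_bits_state_le valid by simp
  qed
  show ?time
  proof (intro exI allI ballI impI)
    fix k n M p g l1 l2 w i :: nat and us cs1 cs2
    assume cs: "cs1 \<in> seeds l1 (par_t k)" "cs2 \<in> seeds l2 2"
      and valid: "valid_params k n M p g l1 l2 \<and> moduli_bounded a k n p l1 l2 \<and>
        word_length_ok c k n M w \<and> valid_stream n M us"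
      and i: "i < length us"
    interpret estimator k n M p g l1 l2 cs1 cs2
      using cs valid by unfold_locales auto
    have st: "process w (take i us) (init k p g l1 l2 cs1 cs2) = state (take i us)"
      using valid by (intro process_state prefix) auto
    obtain j v where u: "us ! i = (j, v)" by fastforce
    then have "(j, v) \<in> set us" using i nth_mem by metis
    then have "j \<in> {1..n}" "\<bar>v\<bar> \<le> int M" using valid by (auto simp: valid_stream_def)
    then show "real (update_time w (us ! i) (process w (take i us) (init k p g l1 l2 cs1 cs2)))
        \<le> 6594 * (4 * log 2 (max 1 a) + 74 / c + 3)\<^sup>2 * log 2 (real k)"
      unfolding st u using valid assms(2) by (intro update_time_state_le) auto
  qed
  show ?correct
    using report_correct_probability[OF assms(1)] by blast
qed

end
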